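(* In the setting of the context, suppose a solution $x^*\in\mathbb R^n$ to $F^*=\min_{x\in\mathbb R^n}\sum_{i\in\mathcal N}\Phi_i(x)$ exists, $\operatorname{ri}\big(\bigcap_{i\in\mathcal N}\operatorname{dom}\xi_i\big)\ne\emptyset$, and $D=\max_{i\in\mathcal N}\sup_{x,x'\in\operatorname{dom}\xi_i}\|x-x'\|<+\infty$. Given arbitrary $\{x_i^0\}_{i\in\mathcal N}\subset\mathbb R^n$ and $\{\gamma_i\}_{i\in\mathcal N}\subset(0,\infty)$, let $\{\mathbf{x}^k\}_{k\ge1}$ be generated by SDPGA with $\{c_i^k\}_{k\ge0}$ chosen such that $\frac1{c_i^k}=\frac1{c_i}+\sqrt k$ and $c_i=(L_i+\gamma_i\|A_i\|^2+1)^{-1}$, where $A_i=\mathbf 1_{d_i}\otimes I_n$ (so $\|A_i\|^2=d_i$), $i\in\mathcal N$. Then the average sequence $\bar{\mathbf{x}}^t=(\bar x_i^t)_{i\in\mathcal N}=\frac1t\sum_{k=1}^t\mathbf{x}^k$ satisfies, for $\bar D=D$ and all $t\ge1$, $$\mathbb E\big[|F(\bar{\mathbf{x}}^t)-F^*|\big]\le\frac1t\Big(\frac{2\|Q\|}{\sigma_{\min}(\Omega)}\sum_{i\in\mathcal N}\kappa_i^2+\sum_{i\in\mathcal N}\frac1{2c_i}\|x^*-x_i^0\|^2\Big)+\frac{N}{2\sqrt t}(\bar D^2+2\sigma^2),$$ $$\mathbb E\Big[\Big(\sum_{(i,j)\in\mathcal E}\|\bar x_i^t-\bar x_j^t\|^2\Big)^{1/2}\Big]\le\frac1t\Big[\|Q\|\Big(\sum_{i\in\mathcal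 N}\frac{\kappa_i^2}{\sigma_{\min}(\Omega)}+1\Big)+\sum_{i\in\mathcal N}\frac1{2c_i}\|x^*-x_i^0\|^2\Big]+\frac{N}{2\sqrt t}(\bar D^2+2\sigma^2),$$ where, for each $i\in\mathcal N$, $\kappa_i>0$ denotes a bound on the elements of $\partial\Phi_i(x^* )$, i.e. $\|q\|\le\kappa_i$ for all $q\in\partial\Phi_i(x^* )$, and $Q=\operatorname{diag}\big([\frac1{\gamma_i}+\frac1{\gamma_j}]_{(i,j)\in\mathcal E}\big)$.
   Context: $\mathcal G=(\mathcal N,\mathcal E)$ is a connected undirected graph with nodes $\mathcal N=\{1,\dots,N\}$, each edge written $(i,j)\in\mathcal E$ with $i<j$. $\mathcal N_i$ is the set of neighbors of $i$ and $d_i=|\mathcal N_i|$. $\Omega$ is the graph Laplacian and $\sigma_{\min}(\Omega)$ its smallest positive eigenvalue. For each $i\in\mathcal N$, $\Phi_i=\xi_i+f_i$, where $\xi_i:\mathbb R^n\to\mathbb R\cup\{+\infty\}$ and $f_i:\mathbb R^n\to\mathbb R$ are closed convex functions such that $f_i$ is differentiable on an open set containing $\operatorname{dom}\xi_i$ with a Lipschitz continuous gradient $\nabla f_i$ whose Lipschitz constant is $L_i$, and the prox map of $\xi_i$ is efficiently computable. $F(\mathbf{x})=\sum_{i\in\mathcal N}\Phi_i(x_i)$ for $\mathbf{x}=(x_i)_{i\in\mathcal N}$. Stochastic first-order oracle (SFO): for each $i$, $G_i:\mathbb R^n\times\Xi\to\mathbb R^n$ is an SFO for $\nabla f_i$ with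 a common parameter $\sigma\in[0,\infty)$, i.e. $\mathbb E_\nu[G_i(x,\nu)]=\nabla f_i(x)$ and $\mathbb E_\nu[\|G_i(x,\nu)-\nabla f_i(x)\|^2]\le\sigma^2$ for all $x\in\operatorname{dom}f_i$ (in the definition of an SFO the domain of the function is open and its gradient exists there), where $\nu\in\Xi$ is a random variable following a certain distribution. The random variables $\{\nu_i^k\in\Xi:i\in\mathcal N,k\ge0\}$ are i.i.d. For $\gamma_i>0$ define $\Gamma\in\mathbb R^{N\times N}$ by $\Gamma_{ij}=0$ if $j\notin\mathcal N_i\cup\{i\}$, $\Gamma_{ij}=-\frac{\gamma_i\gamma_j}{\gamma_i+\gamma_j}$ if $j\in\mathcal N_i$, $\Gamma_{ii}=\sum_{j\in\mathcal N_i}\frac{\gamma_i\gamma_j}{\gamma_i+\gamma_j}$. Algorithm SDPGA with step sizes $c_i^k>0$: initialize $s_i^0=\sum_{j\in\mathcal N_i\cup\{i\}}\Gamma_{ij}x_j^0$, $p_i^0=\mathbf 0$; for $k\ge0$ and all $i\in\mathcal N$, $$x_i^{k+1}=\mathbf{prox}_{c_i^k\xi_i}\big(x_i^k-c_i^k(G_i(x_i^k,\nu_i^k)+p_i^k+s_i^k)\big),\quad s_i^{k+1}=\sum_{j\in\mathcal N_i\cup\{i\}}\Gamma_{ij}x_j^{k+1},\quad p_i^{k+1}=p_i^k+s_i^{k+1},$$ and $\mathbf{x}^k=(x_i^k)_{i\in\mathcal N}$. Notation: $\mathbf{prox}_{\xi}(x)=\operatorname{argmin}_z\{\xi(z)+\frac12\|z-x\|^2\}$;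 $\|\cdot\|$ is the Euclidean norm for vectors and the spectral norm for matrices; $\mathbf 1_{d}\in\mathbb R^d$ is the vector of all ones; $\otimes$ is the Kronecker product; $I_n$ is the $n\times n$ identity; $\operatorname{ri}$ is relative interior.
   Formalization: Two added assumptions, without which the claim fails: each ∂Φ_i(x* ) is nonempty, and the segments from x_i^0 to points of dom ξ_i lie in the open set on which ∇f_i is L_i-Lipschitz (no restriction if that set is R^n). *)

theory Defs
  imports "HOL-Probability.Probability"
begin

section \<open>Convex analysis\<close>

definition edom :: "('a \<Rightarrow> ereal) \<Rightarrow> 'a set" where
  "edom \<phi> = {x. \<phi> x < \<infinity>}"

definition closed_convex :: "('a::euclidean_space \<Rightarrow> ereal) \<Rightarrow> bool" where
  "closed_convex \<phi> \<longleftrightarrow>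
     closed {(x, r::real). \<phi> x \<le> ereal r} \<and> convex {(x, r::real). \<phi> x \<le> ereal r}"

definition subdifferential :: "('a::euclidean_space \<Rightarrow> ereal) \<Rightarrow> 'a \<Rightarrow> 'a set" where
  "subdifferential \<phi> x = {q. \<forall>y. \<phi> x + ereal (q \<bullet> (y - x)) \<le> \<phi> y}"

definition prox :: "('a::euclidean_space \<Rightarrow> ereal) \<Rightarrow> 'a \<Rightarrow> 'a" where
  "prox \<phi> x = (ARG_MIN (\<lambda>z. \<phi> z + ereal ((norm (z - x))\<^sup>2 / 2)) z. True)"

section \<open>Graphs and matrices\<close>

text \<open>The nodes are the elements of a finite linearly ordered type. An undirected edge is stored
  once, as the pair with the smaller node first.\<close>

definition edge_set :: "('v::linorder \<times> 'v) set \<Rightarrow> bool" where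
  "edge_set E \<longleftrightarrow> (\<forall>(i, j)\<in>E. i < j)"

definition connected_graph :: "('v \<times> 'v) set \<Rightarrow> bool" where
  "connected_graph E \<longleftrightarrow> (\<forall>i j. (i, j) \<in> (E \<union> E\<inverse>)\<^sup>*)"

definition nbrs :: "('v \<times> 'v) set \<Rightarrow> 'v \<Rightarrow> 'v set" where
  "nbrs E i = {j. (i, j) \<in> E \<or> (j, i) \<in> E}"

definition laplacian :: "('v::finite \<times> 'v) set \<Rightarrow> real ^ 'v ^ 'v" where
  "laplacian E = (\<chi> i j. if i = j then real (card (nbrs E i))
                          else if j \<in> nbrs E i then - 1 else 0)"

text \<open>The set below is finite, and it is nonempty for a connected graph with at least two nodes.\<close>

definition min_pos_eigenvalue :: "real ^ 'v ^ 'v \<Rightarrow> real" where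
  "min_pos_eigenvalue M = Min {l. 0 < l \<and> (\<exists>v. v \<noteq> 0 \<and> M *v v = l *s v)}"

definition spectral_norm :: "real ^ 'c ^ 'r \<Rightarrow> real" where
  "spectral_norm M = onorm (\<lambda>v. M *v v)"

text \<open>The matrix $\mathbf 1_{d_i} \otimes I_n$, one copy of the identity per neighbour of $i$.
  Its block rows are indexed by all nodes; those of non-neighbours are zero, which does not
  affect the spectral norm.\<close>

definition copy_mat :: "('v::finite \<times> 'v) set \<Rightarrow> 'v \<Rightarrow> real ^ 'n ^ ('v \<times> 'n)" where
  "copy_mat E i = (\<chi> r b. if fst r \<in> nbrs E i \<and> snd r = b then 1 else 0)"

text \<open>The diagonal matrix $Q$ with entries $1/\gamma_i + 1/\gamma_j$ for the edges $(i,j)$,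
  again padded by zero rows and columns for the pairs that are not edges.\<close>

definition Q_mat ::
  "('v::finite \<times> 'v) set \<Rightarrow> ('v \<Rightarrow> real) \<Rightarrow> real ^ ('v \<times> 'v) ^ ('v \<times> 'v)" where
  "Q_mat E \<gamma> = (\<chi> e e'. if e = e' \<and> e \<in> E then 1 / \<gamma> (fst e) + 1 / \<gamma> (snd e) else 0)"

definition Gamma_mat :: "('v::finite \<times> 'v) set \<Rightarrow> ('v \<Rightarrow> real) \<Rightarrow> real ^ 'v ^ 'v" where
  "Gamma_mat E \<gamma> = (\<chi> i j.
     if i = j then \<Sum>l\<in>nbrs E i. \<gamma> i * \<gamma> l / (\<gamma> i + \<gamma> l)
     else if j \<in> nbrs E i then - (\<gamma> i * \<gamma> j / (\<gamma> i + \<gamma> j))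
     else 0)"

section \<open>Stochastic first-order oracles and the algorithm\<close>

text \<open>The stochastic first-order map \<open>G\<close> estimates the gradient \<open>df\<close> of \<open>f\<close> on the open
  domain \<open>U\<close>; the measure \<open>D\<close> is the distribution of the noise. The second moment is a
  nonnegative integral, so that the bound includes its finiteness.\<close>

definition sfo ::
  "'x measure \<Rightarrow> ('a::euclidean_space \<Rightarrow> real) \<Rightarrow> ('a \<Rightarrow> 'a) \<Rightarrow> 'a set
    \<Rightarrow> real \<Rightarrow> ('a \<Rightarrow> 'x \<Rightarrow> 'a) \<Rightarrow> bool" where
  "sfo D f df U \<sigma> G \<longleftrightarrow>
     open U \<and> (\<forall>x\<in>U. GDERIV f x :> df x) \<and>
     (\<lambda>(x, \<nu>). G x \<nu>) \<in> borel_measurable (borel \<Otimes>\<^sub>M D) \<and>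
     (\<forall>x\<in>U. integrable D (G x) \<and> (\<integral>\<nu>. G x \<nu> \<partial>D) = df x \<and>
        (\<integral>\<^sup>+\<nu>. ennreal ((norm (G x \<nu> - df x))\<^sup>2) \<partial>D) \<le> ennreal (\<sigma>\<^sup>2))"

text \<open>One run of SDPGA, for a fixed realisation \<open>\<nu>\<close> of the noise.\<close>

definition sdpga ::
  "('v::finite \<times> 'v) set \<Rightarrow> ('v \<Rightarrow> real) \<Rightarrow> ('v \<Rightarrow> 'a::euclidean_space \<Rightarrow> ereal)
    \<Rightarrow> ('v \<Rightarrow> 'a \<Rightarrow> 'x \<Rightarrow> 'a) \<Rightarrow> ('v \<Rightarrow> nat \<Rightarrow> real) \<Rightarrow> ('v \<Rightarrow> 'a) \<Rightarrow> ('v \<Rightarrow> nat \<Rightarrow> 'x)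
    \<Rightarrow> (nat \<Rightarrow> 'v \<Rightarrow> 'a) \<Rightarrow> (nat \<Rightarrow> 'v \<Rightarrow> 'a) \<Rightarrow> (nat \<Rightarrow> 'v \<Rightarrow> 'a) \<Rightarrow> bool" where
  "sdpga E \<gamma> \<xi> G c x0 \<nu> x s p \<longleftrightarrow>
     (\<forall>i. x 0 i = x0 i \<and>
          s 0 i = (\<Sum>j\<in>nbrs E i \<union> {i}. (Gamma_mat E \<gamma> $ i $ j) *\<^sub>R x0 j) \<and>
          p 0 i = 0) \<and>
     (\<forall>k i. x (Suc k) i = prox (\<lambda>z. ereal (c i k) * \<xi> i z)
                (x k i - c i k *\<^sub>R (G i (x k i) (\<nu> i k) + p k i + s k i)) \<and>
            s (Suc k) i = (\<Sum>j\<in>nbrs E i \<union> {i}. (Gamma_mat E \<gamma> $ i $ j) *\<^sub>R x (Suc k) j) \<and>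
            p (Suc k) i = p k i + s (Suc k) i)"

section \<open>Objective\<close>

definition Phi :: "('a \<Rightarrow> ereal) \<Rightarrow> ('a \<Rightarrow> real) \<Rightarrow> 'a \<Rightarrow> ereal" where
  "Phi \<xi> f x = \<xi> x + ereal (f x)"

definition objective ::
  "('v::finite \<Rightarrow> 'a \<Rightarrow> ereal) \<Rightarrow> ('v \<Rightarrow> 'a \<Rightarrow> real) \<Rightarrow> ('v \<Rightarrow> 'a) \<Rightarrow> ereal" where
  "objective \<xi> f x = (\<Sum>i\<in>UNIV. Phi (\<xi> i) (f i) (x i))"

definition optimal_value ::
  "('v::finite \<Rightarrow> 'a \<Rightarrow> ereal) \<Rightarrow> ('v \<Rightarrow> 'a \<Rightarrow> real) \<Rightarrow> ereal" where
  "optimal_value \<xi> f = (INF x. objective \<xi> f (\<lambda>_. x))"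

end

theory Submission
  imports Defs
begin

text \<open>Let \<open>B\<close> be the incidence matrix of the graph and \<open>W\<close> the diagonal matrix of the harmonic
  weights \<open>\<gamma>\<^sub>i \<gamma>\<^sub>j / (\<gamma>\<^sub>i + \<gamma>\<^sub>j)\<close>. Since the matrix \<open>\<Gamma>\<close> is \<open>B\<^sup>T W B\<close>, the vector \<open>p\<close> equals \<open>B\<^sup>T \<lambda>\<close>
  for multipliers \<open>\<lambda>\<close> performing dual ascent with step \<open>W\<close>. The prox inequality, the descent lemma
  and the dual identity telescope to a bound, for every realisation of the noise and every edge
  vector \<open>u\<close>, of the Lagrangian gap \<open>F(xbar) - F* + \<langle>u, B xbar\<rangle>\<close>; the term \<open>\<gamma>\<^sub>i d\<^sub>i\<close> in the step size
  absorbs the linearisation of the coupling, and \<open>sqrt k\<close> absorbs the noise.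

  An optimal multiplier \<open>- B y\<close> exists because bounded subdifferentials force the solution into the
  interior of all domains, and its norm is controlled by the spectral gap of the Laplacian. As the
  bound is pathwise, \<open>u\<close> may depend on the noise: the choices \<open>0\<close> and \<open>- 2 B y\<close> bound the objective gap,
  and \<open>B xbar / \<parallel>B xbar\<parallel> - B y\<close> bounds the consensus error. Taking expectations, the linear noise
  term vanishes because each iterate is independent of the fresh noise.\<close>

section \<open>Proximal and gradient inequalities\<close>

text \<open>The comparison point is \<open>x^*\<close> for every choice of \<open>u\<close>. Hence
  the noise enters through one random variable that does not involve \<open>u\<close>, and its
  expectation is bounded once for both estimates. The curvature \<open>1/c_i^k\<close> is spent
  three times: \<open>L_i\<close> pays for the descent lemma, \<open>\<gamma>_i d_i\<close> for the
  coupling being evaluated at the old iterate, and \<open>1 + sqrt k\<close> for Young's inequality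
  against the noise. The growing curvature costs \<open>sqrt t D^2 / 2\<close> per node in the
  telescoped distances, and the noise costs \<open>\<sigma>^2 sqrt t\<close> per node; divided by
  \<open>t\<close>, this is the last term of both bounds. \<open>Q\<close> is the inverse of
  \<open>W\<close>: the distance from the multipliers to \<open>u\<close> is measured in the norm of
  \<open>W^{-1}\<close>, and the multipliers start at zero, so only \<open>u^T Q u / 2\<close>
  remains. The starting points are arbitrary. \<open>D\<close> does not bound their distance from
  \<open>x^*\<close>, so they may appear only with the coefficient \<open>1/(2 c_i)\<close>, which
  works because \<open>sqrt 0 = 0\<close>; and the first segment needs a separate reason to stay in
  the set where \<open>f_i\<close> is smooth.\<close>

lemma closed_convex_edom:
  assumes "closed_convex \<phi>" "\<And>z. \<phi> z \<noteq> - \<infinity>" "z \<in> edom \<phi>"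
  shows "\<phi> z = ereal (real_of_ereal (\<phi> z))"
  using assms by (cases "\<phi> z") (auto simp: edom_def)

lemma closed_convex_convex_comb:
  fixes \<phi> :: "'a::euclidean_space \<Rightarrow> ereal"
  assumes cc: "closed_convex \<phi>" and mi: "\<And>z. \<phi> z \<noteq> - \<infinity>"
    and y: "y \<in> edom \<phi>" and z: "z \<in> edom \<phi>" and uv: "0 \<le> u" "0 \<le> v" "u + v = 1"
  shows "\<phi> (u *\<^sub>R y + v *\<^sub>R z) \<le> ereal (u * real_of_ereal (\<phi> y) + v * real_of_ereal (\<phi> z))"
proof -
  let ?S = "{(x, r::real). \<phi> x \<le> ereal r}"
  have "(y, real_of_ereal (\<phi> y)) \<in> ?S" "(z, real_of_ereal (\<phi> z)) \<in> ?S"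
    using closed_convex_edom[OF cc mi y] closed_convex_edom[OF cc mi z] by simp_all
  moreover have "convex ?S" using cc by (simp add: closed_convex_def)
  ultimately have "u *\<^sub>R (y, real_of_ereal (\<phi> y)) + v *\<^sub>R (z, real_of_ereal (\<phi> z)) \<in> ?S"
    using uv by (intro convexD)
  then show ?thesis by simp
qed

lemma convex_edom:
  fixes \<phi> :: "'a::euclidean_space \<Rightarrow> ereal"
  assumes cc: "closed_convex \<phi>" and mi: "\<And>z. \<phi> z \<noteq> - \<infinity>"
  shows "convex (edom \<phi>)"
proof (rule convexI)
  fix y z and u v :: real
  assume *: "y \<in> edom \<phi>" "z \<in> edom \<phi>" "0 \<le> u" "0 \<le> v" "u + v = 1"
  have "\<phi> (u *\<^sub>R y + v *\<^sub>R z) \<le> ereal (u * real_of_ereal (\<phi> y) + v * real_of_ereal (\<phi> z))"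
    by (rule closed_convex_convex_comb[OF cc mi *])
  also have "\<dots> < \<infinity>" by simp
  finally show "u *\<^sub>R y + v *\<^sub>R z \<in> edom \<phi>" by (simp add: edom_def)
qed

lemma convex_on_real_of_closed_convex:
  fixes \<phi> :: "'a::euclidean_space \<Rightarrow> ereal"
  assumes cc: "closed_convex \<phi>" and mi: "\<And>z. \<phi> z \<noteq> - \<infinity>"
  shows "convex_on (edom \<phi>) (\<lambda>z. real_of_ereal (\<phi> z))"
  unfolding convex_on_def
proof (intro conjI ballI allI impI convex_edom[OF cc mi])
  fix y z and u v :: real
  assume *: "y \<in> edom \<phi>" "z \<in> edom \<phi>" "0 \<le> u" "0 \<le> v" "u + v = 1"
  have "u *\<^sub>R y + v *\<^sub>R z \<in> edom \<phi>"
    using convexD[OF convex_edom[OF cc mi] *] .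
  from closed_convex_edom[OF cc mi this] closed_convex_convex_comb[OF cc mi *]
  show "real_of_ereal (\<phi> (u *\<^sub>R y + v *\<^sub>R z))
      \<le> u * real_of_ereal (\<phi> y) + v * real_of_ereal (\<phi> z)"
    by (metis ereal_less_eq(3))
qed

lemma convex_on_of_closed_convex_ereal:
  fixes f :: "'a::euclidean_space \<Rightarrow> real"
  assumes "closed_convex (\<lambda>z. ereal (f z))"
  shows "convex_on UNIV f"
  using convex_on_real_of_closed_convex[OF assms] by (simp add: edom_def)

section \<open>Existence and properties of the proximal point\<close>

lemma closed_prox_sublevel:
  fixes \<phi> :: "'a::euclidean_space \<Rightarrow> ereal"
  assumes cc: "closed_convex \<phi>" and c: "0 < c"
  shows "closed {z. ereal c * \<phi> z + ereal ((norm (z - x))\<^sup>2 / 2) \<le> ereal r}"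
proof -
  \<comment> \<open>Solved for \<open>\<phi> z\<close>, the inequality says that a continuous image
    of \<open>z\<close> lies in the closed epigraph.\<close>
  let ?h = "\<lambda>z. (z, (r - (norm (z - x))\<^sup>2 / 2) / c)"
  have "(ereal c * \<phi> z + ereal ((norm (z - x))\<^sup>2 / 2) \<le> ereal r)
      = (\<phi> z \<le> ereal ((r - (norm (z - x))\<^sup>2 / 2) / c))" for z
    using c by (cases "\<phi> z") (simp_all add: pos_le_divide_eq algebra_simps)
  then have "{z. ereal c * \<phi> z + ereal ((norm (z - x))\<^sup>2 / 2) \<le> ereal r}
      = ?h -` {(x, r::real). \<phi> x \<le> ereal r}"
    by auto
  moreover have "closed (?h -` {(x, r::real). \<phi> x \<le> ereal r})"
    using cc c by (intro closed_vimage continuous_intros) (auto simp: closed_convex_def)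
  ultimately show ?thesis by simp
qed

text \<open>\<open>prox\<close> is a choice operator, so nothing is known about it before a
  minimizer exists. The boundedness of the domain supplies compactness: nested closed sublevel sets
  inside \<open>closure (edom \<phi>)\<close> have a common point, and a point in all nonempty ones
  is a minimizer.\<close>

lemma prox_attained:
  fixes \<phi> :: "'a::euclidean_space \<Rightarrow> ereal"
  assumes cc: "closed_convex \<phi>" and mi: "\<And>z. \<phi> z \<noteq> - \<infinity>"
    and bd: "bounded (edom \<phi>)" and ne: "edom \<phi> \<noteq> {}" and c: "0 < c"
  shows "\<exists>z. is_arg_min (\<lambda>z. ereal c * \<phi> z + ereal ((norm (z - x))\<^sup>2 / 2)) (\<lambda>_. True) z"
proof -
  define h where "h z = ereal c * \<phi> z + ereal ((norm (z - x))\<^sup>2 / 2)" for z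
  define I where "I = {r::real. \<exists>z. h z \<le> ereal r}"
  define K where "K = closure (edom \<phi>)"
  define S where "S r = {z. h z \<le> ereal r}" for r :: real
  have fin: "h z < \<infinity> \<longleftrightarrow> z \<in> edom \<phi>" for z
    using c by (cases "\<phi> z") (auto simp: h_def edom_def)
  have hmi: "h z \<noteq> - \<infinity>" for z
    using c mi[of z] by (cases "\<phi> z") (auto simp: h_def)
  have cl: "closed (S r)" for r
    using closed_prox_sublevel[OF cc c] by (simp add: S_def h_def)
  have sub: "S r \<subseteq> K" for r
  proof
    fix z assume "z \<in> S r"
    then have "h z < \<infinity>" unfolding S_def using le_less_trans less_ereal.simps(4) by blast
    then have "z \<in> edom \<phi>" using fin by blast
    then show "z \<in> K" unfolding K_def using closure_subset by blast
  qed
  have "compact K" using bd by (simp add: K_def)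
  have fip: "K \<inter> (\<Inter>r\<in>J. S r) \<noteq> {}" if J: "finite J" "J \<subseteq> I" for J
  proof (cases "J = {}")
    case True
    then show ?thesis using ne closure_subset by (auto simp: K_def)
  next
    case False
    then have "Min J \<in> I" using J by (meson Min_in subsetD)
    then obtain z where z: "h z \<le> ereal (Min J)" by (auto simp: I_def)
    have "h z \<le> ereal r" if "r \<in> J" for r
      using z Min_le[OF J(1) that] by (meson ereal_less_eq(3) order_trans)
    then have "z \<in> (\<Inter>r\<in>J. S r)" by (auto simp: S_def)
    moreover have "z \<in> K" using z sub[of "Min J"] by (auto simp: S_def)
    ultimately show ?thesis by blast
  qed
  have "K \<inter> (\<Inter>r\<in>I. S r) \<noteq> {}"
    by (rule compact_imp_fip_image[OF \<open>compact K\<close> cl fip])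
  then obtain z where z: "z \<in> (\<Inter>r\<in>I. S r)" by blast
  have "h z \<le> h y" for y
  proof (cases "h y")
    case (real r)
    then have "r \<in> I" unfolding I_def by (metis (mono_tags) mem_Collect_eq order_refl)
    then have "z \<in> S r" using z by blast
    then show ?thesis using real by (simp add: S_def)
  next
    case PInf
    then show ?thesis by simp
  next
    case MInf
    then show ?thesis using hmi[of y] by blast
  qed
  then have "is_arg_min h (\<lambda>_. True) z"
    by (simp add: is_arg_min_def not_less)
  then show ?thesis unfolding h_def by blast
qed

lemma prox_is_arg_min:
  fixes \<phi> :: "'a::euclidean_space \<Rightarrow> ereal"
  assumes "closed_convex \<phi>" "\<And>z. \<phi> z \<noteq> - \<infinity>" "bounded (edom \<phi>)" "edom \<phi> \<noteq> {}" "0 < c"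
  shows "ereal c * \<phi> (prox (\<lambda>z. ereal c * \<phi> z) x)
      + ereal ((norm (prox (\<lambda>z. ereal c * \<phi> z) x - x))\<^sup>2 / 2)
    \<le> ereal c * \<phi> z + ereal ((norm (z - x))\<^sup>2 / 2)"
  using someI_ex[OF prox_attained[OF assms, of x]]
  by (auto simp: prox_def arg_min_def is_arg_min_def not_less)

lemma prox_in_edom:
  fixes \<phi> :: "'a::euclidean_space \<Rightarrow> ereal"
  assumes "closed_convex \<phi>" "\<And>z. \<phi> z \<noteq> - \<infinity>" "bounded (edom \<phi>)" "edom \<phi> \<noteq> {}" "0 < c"
  shows "prox (\<lambda>z. ereal c * \<phi> z) x \<in> edom \<phi>"
proof -
  obtain z where z: "z \<in> edom \<phi>" using assms(4) by blast
  have "ereal c * \<phi> (prox (\<lambda>z. ereal c * \<phi> z) x)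
      + ereal ((norm (prox (\<lambda>z. ereal c * \<phi> z) x - x))\<^sup>2 / 2)
    \<le> ereal (c * real_of_ereal (\<phi> z) + (norm (z - x))\<^sup>2 / 2)"
    using prox_is_arg_min[OF assms, of x z] closed_convex_edom[OF assms(1,2) z]
    by (metis plus_ereal.simps(1) times_ereal.simps(1))
  then show ?thesis
    using assms(5) by (cases "\<phi> (prox (\<lambda>z. ereal c * \<phi> z) x)") (auto simp: edom_def)
qed

text \<open>First-order condition: divide by \<open>\<theta>\<close> and let it tend to 0.\<close>

lemma nonneg_if_quadratic_nonneg:
  fixes a b :: real
  assumes "\<And>\<theta>. 0 < \<theta> \<Longrightarrow> \<theta> \<le> 1 \<Longrightarrow> 0 \<le> \<theta> * a + \<theta>\<^sup>2 * b"
  shows "0 \<le> a"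
proof (rule ccontr)
  assume neg: "\<not> 0 \<le> a"
  \<comment> \<open>Small enough that \<open>\<theta> * b \<le> - a / 2\<close>, which makes
    \<open>a + \<theta> * b\<close> negative; the minimum with 1 keeps \<open>\<theta>\<close>
    admissible.\<close>
  define \<theta> where "\<theta> = min 1 (- a / (2 * (\<bar>b\<bar> + 1)))"
  have \<theta>: "0 < \<theta>" "\<theta> \<le> 1" using neg by (auto simp: \<theta>_def divide_simps)
  have "0 \<le> \<theta> * (a + \<theta> * b)"
    using assms[OF \<theta>] by (simp add: algebra_simps power2_eq_square)
  then have "0 \<le> a + \<theta> * b" using \<theta> by (simp add: zero_le_mult_iff)
  also have "\<theta> * b \<le> \<theta> * (\<bar>b\<bar> + 1)" using \<theta> by (intro mult_left_mono) auto
  also have "\<dots> \<le> (- a / (2 * (\<bar>b\<bar> + 1))) * (\<bar>b\<bar> + 1)"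
    by (intro mult_right_mono) (auto simp: \<theta>_def)
  also have "\<dots> = - a / 2"
    using abs_ge_zero[of b] by (simp add: divide_simps)
  finally show False using neg by simp
qed

lemma norm_add_scaleR_power2:
  fixes a b :: "'a::real_inner"
  shows "(norm (a + \<theta> *\<^sub>R b))\<^sup>2 = (norm a)\<^sup>2 + 2 * \<theta> * (a \<bullet> b) + \<theta>\<^sup>2 * (norm b)\<^sup>2"
  unfolding power2_norm_eq_inner
  by (simp add: inner_add_left inner_add_right inner_commute power2_eq_square)

text \<open>Says that \<open>(x - y) / c\<close> is a subgradient of \<open>\<phi>\<close> at
  \<open>y\<close>. The minimality of \<open>y\<close> is tested along the segment towards
  \<open>z\<close>: convexity bounds the function values, and the squared norm contributes its
  derivative plus a term quadratic in \<open>\<theta>\<close>.\<close>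

lemma prox_variational:
  fixes \<phi> :: "'a::euclidean_space \<Rightarrow> ereal" and x :: 'a
  assumes as: "closed_convex \<phi>" "\<And>z. \<phi> z \<noteq> - \<infinity>" "bounded (edom \<phi>)" "edom \<phi> \<noteq> {}" "0 < c"
    and z: "z \<in> edom \<phi>"
  defines "y \<equiv> prox (\<lambda>z. ereal c * \<phi> z) x"
  shows "c * (real_of_ereal (\<phi> y) - real_of_ereal (\<phi> z)) \<le> (y - x) \<bullet> (z - y)"
proof -
  define g where "g = (\<lambda>z. real_of_ereal (\<phi> z))"
  have y: "y \<in> edom \<phi>" unfolding y_def by (rule prox_in_edom[OF as])
  have \<phi>g: "\<phi> w = ereal (g w)" if "w \<in> edom \<phi>" for w
    using closed_convex_edom[OF as(1,2) that] by (simp add: g_def)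
  have min: "c * g y + (norm (y - x))\<^sup>2 / 2 \<le> c * g w + (norm (w - x))\<^sup>2 / 2"
    if w: "w \<in> edom \<phi>" for w
    using prox_is_arg_min[OF as, of x w] \<phi>g[OF w] \<phi>g[OF y] unfolding y_def[symmetric] by simp
  have "0 \<le> c * (g z - g y) + (y - x) \<bullet> (z - y)"
  proof (rule nonneg_if_quadratic_nonneg[of _ "(norm (z - y))\<^sup>2 / 2"])
    fix \<theta> :: real assume \<theta>: "0 < \<theta>" "\<theta> \<le> 1"
    define w where "w = (1 - \<theta>) *\<^sub>R y + \<theta> *\<^sub>R z"
    have w: "w \<in> edom \<phi>"
      unfolding w_def using \<theta> y z by (intro convexD[OF convex_edom[OF as(1,2)]]) auto
    have "g w \<le> (1 - \<theta>) * g y + \<theta> * g z"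
      using convex_on_real_of_closed_convex[OF as(1,2)] y z \<theta>
      unfolding w_def g_def convex_on_def by auto
    then have "c * g w \<le> c * ((1 - \<theta>) * g y + \<theta> * g z)" using as(5) by simp
    moreover have "w - x = (y - x) + \<theta> *\<^sub>R (z - y)" by (simp add: w_def algebra_simps)
    then have "(norm (w - x))\<^sup>2 / 2
        = (norm (y - x))\<^sup>2 / 2 + \<theta> * ((y - x) \<bullet> (z - y)) + \<theta>\<^sup>2 * ((norm (z - y))\<^sup>2 / 2)"
      by (simp only: norm_add_scaleR_power2) (simp add: field_simps)
    ultimately show "0 \<le> \<theta> * (c * (g z - g y) + (y - x) \<bullet> (z - y)) + \<theta>\<^sup>2 * ((norm (z - y))\<^sup>2 / 2)"
      using min[OF w] by (simp add: algebra_simps)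
  qed
  then show ?thesis by (simp add: g_def algebra_simps)
qed

text \<open>Supplies continuity, hence measurability, of the prox. Test the variational inequality
  at each of the two prox points with the other one; in the sum the function values cancel.\<close>

lemma prox_nonexpansive:
  fixes \<phi> :: "'a::euclidean_space \<Rightarrow> ereal"
  assumes as: "closed_convex \<phi>" "\<And>z. \<phi> z \<noteq> - \<infinity>" "bounded (edom \<phi>)" "edom \<phi> \<noteq> {}" "0 < c"
  defines "T \<equiv> prox (\<lambda>z. ereal c * \<phi> z)"
  shows "norm (T x - T y) \<le> norm (x - y)"
proof -
  have m: "T x \<in> edom \<phi>" "T y \<in> edom \<phi>" unfolding T_def by (rule prox_in_edom[OF as])+
  have "0 \<le> (T x - x) \<bullet> (T y - T x) + (T y - y) \<bullet> (T x - T y)"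
    using prox_variational[OF as m(2), of x] prox_variational[OF as m(1), of y]
    unfolding T_def[symmetric] by (simp add: algebra_simps)
  then have "(norm (T x - T y))\<^sup>2 \<le> (x - y) \<bullet> (T x - T y)"
    unfolding power2_norm_eq_inner by (simp add: inner_simps algebra_simps inner_commute)
  also have "\<dots> \<le> norm (x - y) * norm (T x - T y)" by (rule norm_cauchy_schwarz)
  finally show ?thesis
    by (cases "norm (T x - T y) = 0") (auto simp: power2_eq_square)
qed

lemma borel_measurable_prox:
  fixes \<phi> :: "'a::euclidean_space \<Rightarrow> ereal"
  assumes as: "closed_convex \<phi>" "\<And>z. \<phi> z \<noteq> - \<infinity>" "bounded (edom \<phi>)" "edom \<phi> \<noteq> {}" "0 < c"
  shows "prox (\<lambda>z. ereal c * \<phi> z) \<in> borel_measurable borel"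
proof (intro borel_measurable_continuous_onI lipschitz_on_continuous_on[of 1] lipschitz_onI)
  fix x y show "dist (prox (\<lambda>z. ereal c * \<phi> z) x) (prox (\<lambda>z. ereal c * \<phi> z) y) \<le> 1 * dist x y"
    using prox_nonexpansive[OF as] by (simp add: dist_norm)
qed simp

section \<open>Differentiable functions along segments\<close>

lemma GDERIV_line:
  fixes f :: "'a::real_inner \<Rightarrow> real"
  assumes "GDERIV f (x + t *\<^sub>R d) :> g"
  shows "((\<lambda>t. f (x + t *\<^sub>R d)) has_real_derivative (d \<bullet> g)) (at t)"
proof -
  have "((\<lambda>t. x + t *\<^sub>R d) has_derivative (\<lambda>h. h *\<^sub>R d)) (at t)"
    by (auto intro!: derivative_eq_intros)
  from has_derivative_compose[OF this assms[unfolded gderiv_def]]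
  have "((\<lambda>t. f (x + t *\<^sub>R d)) has_derivative (\<lambda>h. (h *\<^sub>R d) \<bullet> g)) (at t)" .
  then show ?thesis
    unfolding has_field_derivative_def inner_scaleR_left mult_commute_abs .
qed

text \<open>Along the segment, convexity bounds every difference quotient by
  \<open>f z - f x\<close>; the quotients converge to the directional derivative.\<close>

lemma convex_gradient_inequality:
  fixes f :: "'a::real_inner \<Rightarrow> real"
  assumes cv: "convex_on UNIV f" and g: "GDERIV f x :> g"
  shows "f x + g \<bullet> (z - x) \<le> f z"
proof -
  define h where "h t = f (x + t *\<^sub>R (z - x))" for t :: real
  have "(h has_real_derivative ((z - x) \<bullet> g)) (at 0)"
    unfolding h_def using GDERIV_line[of f x 0] g by simp
  then have "((\<lambda>t. (h t - h 0) / t) \<longlongrightarrow> (z - x) \<bullet> g) (at 0)"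
    by (simp add: has_field_derivative_iff)
  then have "((\<lambda>t. (h t - h 0) / t) \<longlongrightarrow> (z - x) \<bullet> g) (at_right 0)"
    by (rule filterlim_mono) (auto simp: at_le)
  moreover have "eventually (\<lambda>t. (h t - h 0) / t \<le> f z - f x) (at_right 0)"
    unfolding eventually_at_right_field
  proof (intro exI[of _ 1] conjI allI impI)
    fix t :: real assume t: "0 < t" "t < 1"
    have "h t = f ((1 - t) *\<^sub>R x + t *\<^sub>R z)" by (simp add: h_def algebra_simps)
    also have "\<dots> \<le> (1 - t) * f x + t * f z"
      using cv t unfolding convex_on_def by auto
    finally show "(h t - h 0) / t \<le> f z - f x"
      using t by (simp add: h_def field_simps)
  qed simp
  ultimately have "(z - x) \<bullet> g \<le> f z - f x"
    by (intro tendsto_upperbound) auto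
  then show ?thesis by (simp add: inner_commute)
qed

text \<open>\<open>f\<close> minus its quadratic model is nonincreasing along the segment, by
  Cauchy-Schwarz and the Lipschitz bound. \<open>U\<close> may fail to be convex, hence the
  hypothesis on the segment.\<close>

lemma descent_inequality:
  fixes f :: "'a::real_inner \<Rightarrow> real"
  assumes seg: "closed_segment x y \<subseteq> U"
    and g: "\<And>z. z \<in> U \<Longrightarrow> GDERIV f z :> df z"
    and lip: "L-lipschitz_on U df"
  shows "f y \<le> f x + df x \<bullet> (y - x) + L / 2 * (norm (y - x))\<^sup>2"
proof -
  define d where "d = y - x"
  define h where "h t = f (x + t *\<^sub>R d) - t * (df x \<bullet> d) - L / 2 * t\<^sup>2 * (norm d)\<^sup>2" for t :: real
  have mem: "x + t *\<^sub>R d \<in> U" if "0 \<le> t" "t \<le> 1" for t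
    using that seg unfolding closed_segment_def d_def
    by (intro subsetD[OF seg]) (auto simp: in_segment algebra_simps)
  have "h 1 \<le> h 0"
  proof (rule DERIV_nonpos_imp_nonincreasing[of 0 1 h])
    fix t :: real assume t: "0 \<le> t" "t \<le> 1"
    have "(h has_real_derivative (d \<bullet> df (x + t *\<^sub>R d) - df x \<bullet> d - L * t * (norm d)\<^sup>2)) (at t)"
      unfolding h_def using GDERIV_line[OF g[OF mem[OF t]]]
      by (auto intro!: derivative_eq_intros)
    moreover have "d \<bullet> df (x + t *\<^sub>R d) - df x \<bullet> d = (df (x + t *\<^sub>R d) - df x) \<bullet> d"
      by (simp add: inner_simps inner_commute)
    moreover have "\<dots> \<le> norm (df (x + t *\<^sub>R d) - df x) * norm d" by (rule norm_cauchy_schwarz)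
    moreover have "norm (df (x + t *\<^sub>R d) - df x) \<le> L * norm (t *\<^sub>R d)"
      using lipschitz_onD[OF lip mem[OF t] mem[of 0]] by (simp add: dist_norm)
    then have "norm (df (x + t *\<^sub>R d) - df x) * norm d \<le> (L * norm (t *\<^sub>R d)) * norm d"
      by (intro mult_right_mono) auto
    moreover have "(L * norm (t *\<^sub>R d)) * norm d = L * t * (norm d)\<^sup>2"
      using t by (simp add: power2_eq_square)
    ultimately show "\<exists>y. (h has_real_derivative y) (at t) \<and> y \<le> 0"
      by (intro exI[of _ "d \<bullet> df (x + t *\<^sub>R d) - df x \<bullet> d - L * t * (norm d)\<^sup>2"] conjI)
        (assumption | linarith)+
  qed simp
  then show ?thesis by (simp add: h_def d_def algebra_simps)
qed

section \<open>Optimality conditions\<close>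

text \<open>At a non-interior point a convex domain has a nonzero normal \<open>a\<close>, in the
  sense of \<open>a \<bullet> x \<le> a \<bullet> y\<close> on the domain. Subtracting nonnegative
  multiples of \<open>a\<close> from a subgradient gives further subgradients, so the
  subdifferential would be unbounded.\<close>

lemma bounded_subdifferential_interior:
  fixes \<phi> :: "'a::euclidean_space \<Rightarrow> ereal"
  assumes cv: "convex (edom \<phi>)" and q: "q \<in> subdifferential \<phi> x"
    and bd: "\<And>q. q \<in> subdifferential \<phi> x \<Longrightarrow> norm q \<le> B"
    and x: "x \<in> edom \<phi>" and mi: "\<phi> x \<noteq> - \<infinity>"
  shows "x \<in> interior (edom \<phi>)"
proof (rule ccontr)
  assume nx: "x \<notin> interior (edom \<phi>)"
  have "\<exists>a. a \<noteq> 0 \<and> (\<forall>y\<in>edom \<phi>. a \<bullet> x \<le> a \<bullet> y)"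
  \<comment> \<open>In the relative interior, the domain must be flat and \<open>a\<close> is normal
    to a hyperplane containing it; on the relative boundary there is a supporting
    hyperplane.\<close>
  proof (cases "x \<in> rel_interior (edom \<phi>)")
    case True
    then have "interior (edom \<phi>) = {}"
      using nx interior_rel_interior_gen[of "edom \<phi>"] by (metis (full_types))
    then obtain a b where "a \<noteq> 0" and ab: "edom \<phi> \<subseteq> {y. a \<bullet> y = b}"
      by (rule empty_interior_subset_hyperplane[OF cv])
    have "a \<bullet> x = a \<bullet> y" if "y \<in> edom \<phi>" for y using ab x that by auto
    then show ?thesis using \<open>a \<noteq> 0\<close> by (metis order_refl)
  next
    case False
    show ?thesis
    proof (rule supporting_hyperplane_rel_boundary[OF cv x False])
      fix a assume "a \<noteq> 0" "\<And>y. y \<in> edom \<phi> \<Longrightarrow> a \<bullet> x \<le> a \<bullet> y"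
      then show ?thesis by (intro exI[of _ a] conjI ballI)
    qed
  qed
  then obtain a where a: "a \<noteq> 0" "\<And>y. y \<in> edom \<phi> \<Longrightarrow> a \<bullet> x \<le> a \<bullet> y" by blast
  \<comment> \<open>Long enough that the shifted subgradient violates the bound, by the triangle
    inequality.\<close>
  define \<tau> where "\<tau> = (norm q + \<bar>B\<bar> + 1) / norm a"
  have \<tau>: "0 \<le> \<tau>" "norm (\<tau> *\<^sub>R a) = norm q + \<bar>B\<bar> + 1"
    using a(1) by (auto simp: \<tau>_def)
  have "q - \<tau> *\<^sub>R a \<in> subdifferential \<phi> x"
    unfolding subdifferential_def
  proof (intro CollectI allI)
    fix y
    show "\<phi> x + ereal ((q - \<tau> *\<^sub>R a) \<bullet> (y - x)) \<le> \<phi> y"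
    proof (cases "y \<in> edom \<phi>")
      case True
      have "0 \<le> \<tau> * (a \<bullet> (y - x))"
        using \<tau>(1) a(2)[OF True] by (intro mult_nonneg_nonneg) (auto simp: inner_diff_right)
      then have "(q - \<tau> *\<^sub>R a) \<bullet> (y - x) \<le> q \<bullet> (y - x)"
        by (simp add: inner_diff_left)
      then have "\<phi> x + ereal ((q - \<tau> *\<^sub>R a) \<bullet> (y - x)) \<le> \<phi> x + ereal (q \<bullet> (y - x))"
        by (intro add_left_mono) (simp only: ereal_less_eq)
      also have "\<dots> \<le> \<phi> y" using q by (simp add: subdifferential_def)
      finally show ?thesis .
    qed (simp add: edom_def)
  qed
  then have "norm (q - \<tau> *\<^sub>R a) \<le> B" by (rule bd)
  moreover have "norm (\<tau> *\<^sub>R a) - norm q \<le> norm (q - \<tau> *\<^sub>R a)"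
    by (metis norm_minus_commute norm_triangle_ineq2)
  ultimately show False using \<tau>(2) by linarith
qed

text \<open>Separates the origin from the set of all \<open>(z - (y, \<dots>, y), r)\<close> with
  \<open>r > (\<Sum>i. \<phi> i (z i)) - (\<Sum>i. \<phi> i x)\<close>. The free shift \<open>y\<close> makes the multipliers sum to zero, and
  interiority of \<open>x\<close> excludes a vertical hyperplane.\<close>

lemma minimizer_sum_subgradients:
  fixes g :: "'v::finite \<Rightarrow> 'a::euclidean_space \<Rightarrow> real" and C :: "'v \<Rightarrow> 'a set"
  assumes cv: "\<And>i. convex_on (C i) (g i)"
    and int: "\<And>i. x \<in> interior (C i)"
    and min: "\<And>z. (\<And>i. z \<in> C i) \<Longrightarrow> (\<Sum>i\<in>UNIV. g i x) \<le> (\<Sum>i\<in>UNIV. g i z)"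
  shows "\<exists>q. (\<Sum>i\<in>UNIV. q i) = 0 \<and> (\<forall>i. \<forall>z\<in>C i. g i x + q i \<bullet> (z - x) \<le> g i z)"
proof -
  define S :: "(('a ^ 'v) \<times> real) set" where
    "S = {w. \<exists>z y. (\<forall>i. z $ i \<in> C i) \<and> fst w = (\<chi> i. z $ i - y)
              \<and> (\<Sum>i\<in>UNIV. g i (z $ i)) - (\<Sum>i\<in>UNIV. g i x) < snd w}"
  have xC: "x \<in> C i" for i using int interior_subset by blast
  have SI: "((\<chi> i. z i - y), r) \<in> S"
    if "\<And>i. z i \<in> C i" "(\<Sum>i\<in>UNIV. g i (z i)) - (\<Sum>i\<in>UNIV. g i x) < r" for z y r
    using that unfolding S_def by (intro CollectI exI[of _ "\<chi> i. z i"] exI[of _ y]) simp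
  have "convex S"
  proof (rule convexI)
    fix w w' and u v :: real
    assume w: "w \<in> S" "w' \<in> S" and uv: "0 \<le> u" "0 \<le> v" "u + v = 1"
    obtain z y where z: "\<And>i. z $ i \<in> C i" "fst w = (\<chi> i. z $ i - y)"
      "(\<Sum>i\<in>UNIV. g i (z $ i)) - (\<Sum>i\<in>UNIV. g i x) < snd w"
      using w(1) unfolding S_def by blast
    obtain z' y' where z': "\<And>i. z' $ i \<in> C i" "fst w' = (\<chi> i. z' $ i - y')"
      "(\<Sum>i\<in>UNIV. g i (z' $ i)) - (\<Sum>i\<in>UNIV. g i x) < snd w'"
      using w(2) unfolding S_def by blast
    have mem: "u *\<^sub>R (z $ i) + v *\<^sub>R (z' $ i) \<in> C i" for i
      using cv[of i] z(1)[of i] z'(1)[of i] uv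
      by (intro convexD) (auto simp: convex_on_def)
    have "g i (u *\<^sub>R (z $ i) + v *\<^sub>R (z' $ i)) \<le> u * g i (z $ i) + v * g i (z' $ i)" for i
      using cv[of i] z(1)[of i] z'(1)[of i] uv by (auto simp: convex_on_def)
    then have "(\<Sum>i\<in>UNIV. g i (u *\<^sub>R (z $ i) + v *\<^sub>R (z' $ i)))
        \<le> u * (\<Sum>i\<in>UNIV. g i (z $ i)) + v * (\<Sum>i\<in>UNIV. g i (z' $ i))"
      by (simp add: sum_distrib_left sum.distrib[symmetric] sum_mono)
    moreover have "(\<Sum>i\<in>UNIV. g i x) = u * (\<Sum>i\<in>UNIV. g i x) + v * (\<Sum>i\<in>UNIV. g i x)"
      using uv by (metis distrib_right mult_1)
    moreover have "u * (\<Sum>i\<in>UNIV. g i (z $ i)) + v * (\<Sum>i\<in>UNIV. g i (z' $ i))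
        - (u * (\<Sum>i\<in>UNIV. g i x) + v * (\<Sum>i\<in>UNIV. g i x)) < u * snd w + v * snd w'"
    proof -
      have 1: "u * ((\<Sum>i\<in>UNIV. g i (z $ i)) - (\<Sum>i\<in>UNIV. g i x)) \<le> u * snd w"
        "v * ((\<Sum>i\<in>UNIV. g i (z' $ i)) - (\<Sum>i\<in>UNIV. g i x)) \<le> v * snd w'"
        using z(3) z'(3) uv by (auto intro!: mult_left_mono)
      \<comment> \<open>Strictness survives because the weights cannot both vanish.\<close>
      have "0 < u \<or> 0 < v" using uv by linarith
      then have "u * ((\<Sum>i\<in>UNIV. g i (z $ i)) - (\<Sum>i\<in>UNIV. g i x)) < u * snd w \<or>
        v * ((\<Sum>i\<in>UNIV. g i (z' $ i)) - (\<Sum>i\<in>UNIV. g i x)) < v * snd w'"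
        using z(3) z'(3) by (metis mult_strict_left_mono)
      then show ?thesis using 1 by (auto simp: algebra_simps)
    qed
    ultimately have "((\<chi> i. (u *\<^sub>R (z $ i) + v *\<^sub>R (z' $ i)) - (u *\<^sub>R y + v *\<^sub>R y')),
        u * snd w + v * snd w') \<in> S"
      using mem by (intro SI) auto
    also have "((\<chi> i. (u *\<^sub>R (z $ i) + v *\<^sub>R (z' $ i)) - (u *\<^sub>R y + v *\<^sub>R y')),
        u * snd w + v * snd w') = u *\<^sub>R w + v *\<^sub>R w'"
      by (intro prod_eqI) (auto simp: z(2) z'(2) vec_eq_iff algebra_simps)
    finally show "u *\<^sub>R w + v *\<^sub>R w' \<in> S" .
  qed
  moreover have "0 \<notin> S"
  proof
    assume "0 \<in> S"
    then obtain z y where z: "\<And>i. z $ i \<in> C i" "(0::'a ^ 'v) = (\<chi> i. z $ i - y)"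
      "(\<Sum>i\<in>UNIV. g i (z $ i)) - (\<Sum>i\<in>UNIV. g i x) < 0"
      unfolding S_def by auto
    have "z $ i = y" for i using z(2) by (simp add: vec_eq_iff)
    then show False using min[of y] z by auto
  qed
  ultimately have "\<exists>ab. ab \<noteq> 0 \<and> (\<forall>w\<in>S. 0 \<le> ab \<bullet> w)"
    by (rule separating_hyperplane_set_0)
  then obtain ab where ab: "ab \<noteq> 0" "\<forall>w\<in>S. 0 \<le> ab \<bullet> w" by blast
  obtain a \<alpha> where [simp]: "ab = (a, \<alpha>)" by (cases ab)
  have main: "0 \<le> (\<Sum>i\<in>UNIV. a $ i \<bullet> (z i - y)) + \<alpha> * r"
    if "\<And>i. z i \<in> C i" "(\<Sum>i\<in>UNIV. g i (z i)) - (\<Sum>i\<in>UNIV. g i x) < r" for z y r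
    using bspec[OF ab(2) SI[OF that]] by (simp add: inner_vec_def)
  \<comment> \<open>An affine function bounded below on the whole line has slope zero.\<close>
  have zero: "c = 0" if "\<And>h::real. 0 \<le> b + h * c" for b c :: real
  proof (rule ccontr)
    assume "c \<noteq> 0"
    with that[of "(- b - 1) / c"] show False by simp
  qed
  have sum0: "(\<Sum>i\<in>UNIV. a $ i) = 0"
  proof -
    define A where "A = (\<Sum>i\<in>UNIV. a $ i)"
    have "A \<bullet> A = (\<Sum>i\<in>UNIV. a $ i \<bullet> A)"
      unfolding inner_sum_left[symmetric] A_def[symmetric] ..
    \<comment> \<open>All points stay at \<open>x\<close> while the free shift runs along the line
      in direction \<open>A\<close>; 1 is an arbitrary level above the zero increase.\<close>
    then have "0 \<le> \<alpha> + h * (A \<bullet> A)" for h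
      using main[of "\<lambda>_. x" 1 "x - h *\<^sub>R A"] xC
      by (simp add: sum_distrib_left add.commute)
    then have "A \<bullet> A = 0" by (rule zero)
    then show ?thesis by (simp add: A_def)
  qed
  have "0 \<le> \<alpha>"
    using main[of "\<lambda>_. x" 1 x] xC by simp
  have "\<alpha> \<noteq> 0"
  proof
    assume \<alpha>: "\<alpha> = 0"
    have "a $ i = 0" for i
    proof -
      obtain e where e: "0 < e" "cball x e \<subseteq> C i"
        using int[of i] mem_interior_cball by blast
      \<comment> \<open>A step against \<open>a $ i\<close> inside the ball; moving only node
        \<open>i\<close> this way gives a negative value unless \<open>a $ i = 0\<close>. The
        \<open>+ 1\<close> avoids a division by zero.\<close>
      define w where "w = - (e / (norm (a $ i) + 1)) *\<^sub>R (a $ i)"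
      have "norm w = e * (norm (a $ i) / (norm (a $ i) + 1))"
        using e by (simp add: w_def)
      also have "\<dots> \<le> e * 1"
        using e norm_ge_zero[of "a $ i"]
        by (intro mult_left_mono, subst divide_le_eq_1_pos) linarith+
      finally have "norm w \<le> e" by simp
      then have "x + w \<in> C i" using e by (auto simp: dist_norm)
      then have "0 \<le> (\<Sum>j\<in>UNIV. a $ j \<bullet> ((if j = i then x + w else x) - x)) + \<alpha> *
          ((\<Sum>j\<in>UNIV. g j (if j = i then x + w else x)) - (\<Sum>i\<in>UNIV. g i x) + 1)"
        using xC by (intro main) auto
      also have "\<dots> = (\<Sum>j\<in>UNIV. if j = i then a $ i \<bullet> w else 0)"
        unfolding \<alpha> mult_zero_left add_0_right by (intro sum.cong) auto
      also have "\<dots> = - (e / (norm (a $ i) + 1)) * (a $ i \<bullet> a $ i)"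
        by (simp add: w_def)
      finally have "(e / (norm (a $ i) + 1)) * (a $ i \<bullet> a $ i) \<le> 0" by simp
      moreover have "0 < e / (norm (a $ i) + 1)" using e by (intro divide_pos_pos) (auto intro: add_nonneg_pos)
      ultimately show ?thesis
        by (metis inner_eq_zero_iff inner_ge_zero mult_pos_pos not_less order_le_less)
    qed
    then have "a = 0" by (simp add: vec_eq_iff)
    then show False using ab(1) \<alpha> by (simp add: zero_prod_def)
  qed
  with \<open>0 \<le> \<alpha>\<close> have \<alpha>: "0 < \<alpha>" by simp
  have sub: "g i x + (- (1 / \<alpha>) *\<^sub>R (a $ i)) \<bullet> (z - x) \<le> g i z" if z: "z \<in> C i" for i z
  proof (rule field_le_epsilon)
    \<comment> \<open>\<open>S\<close> bounds the increase strictly, so it can be matched only up to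
      \<open>\<epsilon>\<close>.\<close>
    fix \<epsilon> :: real assume \<epsilon>: "0 < \<epsilon>"
    define Z where "Z j = (if j = i then z else x)" for j
    have "(\<Sum>j\<in>UNIV. g j (Z j)) - (\<Sum>j\<in>UNIV. g j x) = (\<Sum>j\<in>UNIV. if j = i then g i z - g i x else 0)"
      unfolding sum_subtractf[symmetric] by (intro sum.cong) (auto simp: Z_def)
    then have d: "(\<Sum>j\<in>UNIV. g j (Z j)) - (\<Sum>j\<in>UNIV. g j x) = g i z - g i x" by simp
    have "0 \<le> (\<Sum>j\<in>UNIV. a $ j \<bullet> (Z j - x)) + \<alpha> * (g i z - g i x + \<epsilon>)"
      using d z xC \<epsilon> by (intro main) (auto simp: Z_def)
    also have "(\<Sum>j\<in>UNIV. a $ j \<bullet> (Z j - x)) = (\<Sum>j\<in>UNIV. if j = i then a $ i \<bullet> (z - x) else 0)"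
      by (intro sum.cong) (auto simp: Z_def)
    finally have "0 \<le> a $ i \<bullet> (z - x) + \<alpha> * (g i z - g i x + \<epsilon>)" by simp
    then have "0 \<le> (a $ i \<bullet> (z - x) + \<alpha> * (g i z - g i x + \<epsilon>)) / \<alpha>" using \<alpha> by simp
    then show "g i x + (- (1 / \<alpha>) *\<^sub>R (a $ i)) \<bullet> (z - x) \<le> g i z + \<epsilon>"
      using \<alpha> by (simp add: add_divide_distrib)
  qed
  have "(\<Sum>i\<in>UNIV. - (1 / \<alpha>) *\<^sub>R (a $ i)) = 0"
    using sum0 by (simp only: scaleR_sum_right[symmetric]) simp
  then show ?thesis
    using sub by (intro exI[of _ "\<lambda>i. - (1 / \<alpha>) *\<^sub>R (a $ i)"]) blast
qed

section \<open>Graph Laplacian\<close>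

lemma edge_set_disjoint: "edge_set E \<Longrightarrow> E \<inter> E\<inverse> = {}"
  unfolding edge_set_def by (auto dest: less_asym)

section \<open>Spectral norms of the matrices in the step size and in the rate\<close>

lemma matrix_vector_norm_le_spectral:
  fixes M :: "real ^ 'c ^ 'r"
  shows "norm (M *v v) \<le> spectral_norm M * norm v"
  unfolding spectral_norm_def by (intro onorm matrix_vector_mul_bounded_linear)

lemma spectral_norm_nonneg: "0 \<le> spectral_norm (M :: real ^ 'c ^ 'r)"
  unfolding spectral_norm_def by (intro onorm_pos_le matrix_vector_mul_bounded_linear)

text \<open>A coordinate vector is mapped to a vector with one entry 1 per neighbour. In this
  direction the choice of step size yields the curvature \<open>\<gamma> i * d_i\<close>.\<close>

lemma card_nbrs_le_copy_mat:
  fixes E :: "('v::finite \<times> 'v) set"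
  shows "real (card (nbrs E i)) \<le> (spectral_norm (copy_mat E i :: real ^ 'n ^ ('v \<times> 'n)))\<^sup>2"
proof -
  fix b :: 'n
  let ?M = "copy_mat E i :: real ^ 'n ^ ('v \<times> 'n)"
  let ?v = "axis b 1 :: real ^ 'n"
  have comp: "(?M *v ?v) $ r = (if r \<in> nbrs E i \<times> {b} then 1 else 0)" for r
    by (cases r) (auto simp: matrix_vector_mult_basis column_def copy_mat_def)
  have "(norm (?M *v ?v))\<^sup>2 = (\<Sum>r\<in>UNIV. if r \<in> nbrs E i \<times> {b} then 1 else 0)"
    unfolding power2_norm_eq_inner inner_vec_def comp by (intro sum.cong) auto
  also have "\<dots> = real (card (nbrs E i))"
    by (simp add: sum.If_cases card_cartesian_product)
  finally have "real (card (nbrs E i)) = (norm (?M *v ?v))\<^sup>2" by simp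
  also have "\<dots> \<le> (spectral_norm ?M * norm ?v)\<^sup>2"
    by (intro power_mono matrix_vector_norm_le_spectral) simp
  finally show ?thesis by simp
qed

text \<open>Evaluate at the eigenvector \<open>axis e 1\<close>. This lets
  \<open>\<parallel>Q\<parallel>\<close> replace the individual edge weights.\<close>

lemma Q_entry_le_spectral_norm:
  assumes "e \<in> E" "\<And>i. 0 < \<gamma> i"
  shows "1 / \<gamma> (fst e) + 1 / \<gamma> (snd e) \<le> spectral_norm (Q_mat E \<gamma>)"
proof -
  let ?v = "axis e 1"
  have "Q_mat E \<gamma> *v ?v = (1 / \<gamma> (fst e) + 1 / \<gamma> (snd e)) *\<^sub>R ?v"
    unfolding matrix_vector_mult_basis using assms(1)
    by (auto simp: vec_eq_iff column_def Q_mat_def axis_def)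
  then have "norm (Q_mat E \<gamma> *v ?v) = 1 / \<gamma> (fst e) + 1 / \<gamma> (snd e)"
    using assms(2)[of "fst e"] assms(2)[of "snd e"] by simp
  then show ?thesis using matrix_vector_norm_le_spectral[of "Q_mat E \<gamma>" ?v] by simp
qed

text \<open>For a graph with a single node \<open>min_pos_eigenvalue\<close> is the
  \<open>Min\<close> of an empty set; the factor 0 cancels the quotient in which it occurs.\<close>

lemma spectral_norm_Q_empty: "spectral_norm (Q_mat {} \<gamma>) = 0"
proof -
  have "Q_mat {} \<gamma> = 0" by (simp add: Q_mat_def vec_eq_iff)
  then show ?thesis by (simp add: spectral_norm_def onorm_zero)
qed

lemma nbrs_irrefl: "edge_set E \<Longrightarrow> i \<notin> nbrs E i"
  by (auto simp: nbrs_def edge_set_def)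

text \<open>Summation by parts: with incidence matrix \<open>B\<close> and edge weights \<open>w\<close> this reads
  \<open>\<langle>u, B\<^sup>T W B x\<rangle> = \<langle>B u, W B x\<rangle>\<close>.\<close>

lemma sum_inner_nbrs:
  fixes E :: "('v::{finite, linorder} \<times> 'v) set" and u :: "'v \<Rightarrow> 'a::real_inner"
  assumes E: "edge_set E" and asym: "\<And>i j. h j i = - h i j"
  shows "(\<Sum>i\<in>UNIV. u i \<bullet> (\<Sum>j\<in>nbrs E i. h i j)) = (\<Sum>(i, j)\<in>E. (u i - u j) \<bullet> h i j)"
proof -
  note disj = edge_set_disjoint[OF E]
  have nb: "nbrs E i = {j. (i, j) \<in> E \<union> E\<inverse>}" for i by (auto simp: nbrs_def)
  have "(\<Sum>i\<in>UNIV. u i \<bullet> (\<Sum>j\<in>nbrs E i. h i j))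
      = (\<Sum>i\<in>UNIV. \<Sum>j\<in>nbrs E i. u i \<bullet> h i j)"
    by (simp add: inner_sum_right)
  also have "\<dots> = (\<Sum>(i, j)\<in>Sigma UNIV (nbrs E). u i \<bullet> h i j)"
    by (rule sum.Sigma) auto
  \<comment> \<open>Both orientations of every edge; they are disjoint because edges are stored in
    increasing order.\<close>
  also have "Sigma UNIV (nbrs E) = E \<union> E\<inverse>" by (auto simp: nb)
  also have "(\<Sum>(i, j)\<in>E \<union> E\<inverse>. u i \<bullet> h i j)
      = (\<Sum>(i, j)\<in>E. u i \<bullet> h i j) + (\<Sum>(i, j)\<in>E\<inverse>. u i \<bullet> h i j)"
    using disj by (intro sum.union_disjoint) auto
  also have "(\<Sum>(i, j)\<in>E\<inverse>. u i \<bullet> h i j) = (\<Sum>(i, j)\<in>E. u j \<bullet> h j i)"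
    by (intro sum.reindex_bij_witness[of _ prod.swap prod.swap]) auto
  also have "\<dots> = (\<Sum>(i, j)\<in>E. - (u j \<bullet> h i j))"
    unfolding case_prod_unfold by (intro sum.cong refl) (metis asym inner_minus_right)
  finally show ?thesis
    by (simp add: sum.distrib[symmetric] inner_diff_left case_prod_unfold)
qed

text \<open>Double counting: a node occurs once for each incident edge. Transfers the curvature
  terms with \<open>\<gamma> i * d_i\<close> from nodes to edges.\<close>

lemma sum_nbrs_eq:
  fixes E :: "('v::{finite, linorder} \<times> 'v) set" and g :: "'v \<Rightarrow> real"
  assumes E: "edge_set E"
  shows "(\<Sum>i\<in>UNIV. real (card (nbrs E i)) * g i) = (\<Sum>(i, j)\<in>E. g i + g j)"
proof -
  note disj = edge_set_disjoint[OF E]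
  have "(\<Sum>i\<in>UNIV. real (card (nbrs E i)) * g i) = (\<Sum>i\<in>UNIV. \<Sum>j\<in>nbrs E i. g i)" by simp
  also have "\<dots> = (\<Sum>(i, j)\<in>Sigma UNIV (nbrs E). g i)" by (rule sum.Sigma) auto
  also have "Sigma UNIV (nbrs E) = E \<union> E\<inverse>" by (auto simp: nbrs_def)
  also have "(\<Sum>(i, j)\<in>E \<union> E\<inverse>. g i) = (\<Sum>(i, j)\<in>E. g i) + (\<Sum>(i, j)\<in>E\<inverse>. g i)"
    using disj by (intro sum.union_disjoint) auto
  also have "(\<Sum>(i, j)\<in>E\<inverse>. g i) = (\<Sum>(i, j)\<in>E. g j)"
    by (intro sum.reindex_bij_witness[of _ prod.swap prod.swap]) auto
  finally show ?thesis by (simp add: sum.distrib[symmetric] case_prod_unfold)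
qed

section \<open>Quadratic form and spectrum of the Laplacian\<close>

lemma laplacian_mult:
  assumes "edge_set E"
  shows "(laplacian E *v y) $ i = (\<Sum>j\<in>nbrs E i. y $ i - y $ j)"
proof -
  have "(laplacian E *v y) $ i
      = (\<Sum>j\<in>UNIV. (if j = i then real (card (nbrs E i)) * y $ i else 0)
          - (if j \<in> nbrs E i then y $ j else 0))"
    unfolding matrix_vector_mult_def laplacian_def vec_lambda_beta
    using nbrs_irrefl[OF assms] by (intro sum.cong) auto
  also have "\<dots> = real (card (nbrs E i)) * y $ i - (\<Sum>j\<in>nbrs E i. y $ j)"
    by (simp add: sum_subtractf sum.If_cases)
  finally show ?thesis by (simp add: sum_subtractf)
qed

text \<open>The factorization \<open>B^T B\<close>. Symmetry, nonnegativity and the kernel of the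
  Laplacian are all read off from it.\<close>

lemma inner_laplacian:
  assumes "edge_set E"
  shows "u \<bullet> (laplacian E *v y) = (\<Sum>(i, j)\<in>E. (u $ i - u $ j) * (y $ i - y $ j))"
  using sum_inner_nbrs[OF assms, of "\<lambda>i j. y $ i - y $ j" "\<lambda>i. u $ i"]
  by (simp add: inner_vec_def laplacian_mult[OF assms])

lemma connected_constant:
  assumes con: "connected_graph E" and eq: "\<And>i j. (i, j) \<in> E \<Longrightarrow> y i = y j"
  shows "y i = y j"
proof -
  have "(i, j) \<in> (E \<union> E\<inverse>)\<^sup>*" using con by (auto simp: connected_graph_def)
  then show ?thesis by (induction rule: rtrancl_induct) (use eq in force)+
qed

lemma laplacian_form_eq_0_imp_constant:
  fixes y :: "real ^ ('v::{finite, linorder})"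
  assumes "edge_set E" "connected_graph E" and 0: "y \<bullet> (laplacian E *v y) = 0"
  shows "y $ i = y $ j"
proof (rule connected_constant[OF assms(2)])
  fix i j assume e: "(i, j) \<in> E"
  have "(\<Sum>e\<in>E. (y $ fst e - y $ snd e) * (y $ fst e - y $ snd e)) = 0"
    using 0 by (simp add: inner_laplacian[OF assms(1)] case_prod_unfold)
  then have "\<forall>e\<in>E. (y $ fst e - y $ snd e) * (y $ fst e - y $ snd e) = 0"
    by (subst (asm) sum_nonneg_eq_0_iff) auto
  with e show "y $ i = y $ j" by force
qed

lemma constant_sum_0_imp_0:
  fixes y :: "real ^ ('v::finite)"
  assumes "\<And>i j. y $ i = y $ j" "(\<Sum>i\<in>UNIV. y $ i) = 0"
  shows "y = 0"
proof -
  have "y $ i = 0" for i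
  proof -
    have "(\<Sum>j\<in>UNIV. y $ j) = (\<Sum>j\<in>(UNIV::'v set). y $ i)"
      by (intro sum.cong refl assms(1))
    then show ?thesis using assms(2) by simp
  qed
  then show ?thesis by (simp add: vec_eq_iff)
qed

lemma laplacian_symmetric:
  assumes "edge_set E"
  shows "u \<bullet> (laplacian E *v y) = (laplacian E *v u) \<bullet> y"
  by (subst inner_commute[of _ y]) (simp only: inner_laplacian[OF assms] mult.commute)

text \<open>\<open>min_pos_eigenvalue\<close> is a \<open>Min\<close>, so finiteness has to be
  known. Eigenvectors for distinct eigenvalues are orthogonal; one chosen eigenvector per eigenvalue
  embeds the spectrum into a pairwise orthogonal set.\<close>

lemma finite_eigenvalues_symmetric:
  fixes M :: "real ^ 'v ^ 'v"
  assumes sym: "\<And>u y. u \<bullet> (M *v y) = (M *v u) \<bullet> y"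
  shows "finite {l. \<exists>v. v \<noteq> 0 \<and> M *v v = l *s v}"
proof -
  define L where "L = {l. \<exists>v. v \<noteq> 0 \<and> M *v v = l *s v}"
  define ev where "ev l = (SOME v. v \<noteq> 0 \<and> M *v v = l *s v)" for l
  have ev: "ev l \<noteq> 0" "M *v ev l = l *s ev l" if "l \<in> L" for l
    using someI_ex[of "\<lambda>v. v \<noteq> 0 \<and> M *v v = l *s v"] that by (auto simp: L_def ev_def)
  have orth: "ev k \<bullet> ev l = 0" if "k \<in> L" "l \<in> L" "k \<noteq> l" for k l
  proof -
    have "l * (ev k \<bullet> ev l) = k * (ev k \<bullet> ev l)"
      using sym[of "ev k" "ev l"] ev(2)[OF that(1)] ev(2)[OF that(2)]
      by (simp add: scalar_mult_eq_scaleR)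
    then show ?thesis using that(3) by simp
  qed
  have inj: "inj_on ev L"
  proof (rule inj_onI, rule ccontr)
    fix k l assume *: "k \<in> L" "l \<in> L" "ev k = ev l" "k \<noteq> l"
    then show False using orth[OF *(1,2,4)] ev(1)[OF *(1)] by simp
  qed
  have "pairwise orthogonal (ev ` L)"
    using orth by (auto simp: pairwise_def orthogonal_def)
  then have "finite (ev ` L)" by (rule pairwise_orthogonal_imp_finite)
  then show ?thesis using finite_imageD[OF _ inj] by (simp add: L_def)
qed

text \<open>A minimizer of the quadratic form on the unit sphere of the mean-zero space is an eigenvector;
  its eigenvalue is positive because the graph is connected.\<close>

lemma laplacian_spectral_gap:
  fixes E :: "('v::{finite, linorder} \<times> 'v) set" and y :: "real ^ ('v::{finite, linorder})"
  assumes E: "edge_set E" and con: "connected_graph E" and N: "2 \<le> CARD('v)"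
  defines "\<sigma> \<equiv> min_pos_eigenvalue (laplacian E)"
  shows "0 < \<sigma>" "(\<Sum>i\<in>UNIV. y $ i) = 0 \<Longrightarrow> \<sigma> * (norm y)\<^sup>2 \<le> y \<bullet> (laplacian E *v y)"
proof -
  define W where "W = {y :: real ^ ('v::{finite, linorder}). (\<Sum>i\<in>UNIV. y $ i) = 0}"
  let ?L = "laplacian E"
  have subW: "subspace W"
    by (auto simp: W_def subspace_def sum.distrib sum_distrib_left[symmetric])
  have LW: "?L *v u \<in> W" for u
  proof -
    have "(\<Sum>i\<in>UNIV. (?L *v u) $ i) = (\<chi> i. 1) \<bullet> (?L *v u)" by (simp add: inner_vec_def)
    also have "\<dots> = 0" by (simp add: inner_laplacian[OF E])
    finally show ?thesis by (simp add: W_def)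
  qed
  have nonneg: "0 \<le> u \<bullet> (?L *v u)" for u
    by (auto simp: inner_laplacian[OF E] intro!: sum_nonneg)
  have clW: "closed W" using subW by (rule closed_subspace)
  have "compact (sphere 0 1 \<inter> W)" using clW by (intro compact_Int_closed) auto
  moreover have "sphere 0 1 \<inter> W \<noteq> {}"
  proof -
    obtain a b :: 'v where ab: "a \<noteq> b"
      using N by (metis card_2_iff' card_le_Suc0_iff_eq finite_code not_less_eq_eq numeral_2_eq_2 UNIV_I)
    define u :: "real ^ ('v::{finite, linorder})" where "u = axis a 1 - axis b 1"
    have "u \<in> W" by (simp add: u_def W_def sum_subtractf axis_def)
    moreover have "u $ a = 1" using ab by (simp add: u_def axis_def)
    then have "u \<noteq> 0" by auto
    ultimately have "(1 / norm u) *\<^sub>R u \<in> sphere 0 1 \<inter> W"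
      using subspace_scale[OF subW] by simp
    then show ?thesis by blast
  qed
  moreover have "continuous_on (sphere 0 1 \<inter> W) (\<lambda>u. u \<bullet> (?L *v u))"
    by (intro continuous_intros linear_continuous_on matrix_vector_mul_bounded_linear)
  ultimately have "\<exists>v\<in>sphere 0 1 \<inter> W. \<forall>u\<in>sphere 0 1 \<inter> W. v \<bullet> (?L *v v) \<le> u \<bullet> (?L *v u)"
    by (rule continuous_attains_inf)
  then obtain v where v: "v \<in> sphere 0 1 \<inter> W"
    and vmin: "\<forall>u\<in>sphere 0 1 \<inter> W. v \<bullet> (?L *v v) \<le> u \<bullet> (?L *v u)"
    by blast
  define \<mu> where "\<mu> = v \<bullet> (?L *v v)"
  have vv: "v \<bullet> v = 1" using v by (simp add: norm_eq_1[symmetric])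
  have ray: "\<mu> * (u \<bullet> u) \<le> u \<bullet> (?L *v u)" if u: "u \<in> W" for u
  proof (cases "u = 0")
    case False
    have "(1 / norm u) *\<^sub>R u \<in> sphere 0 1 \<inter> W"
      using subspace_scale[OF subW u] False by simp
    from bspec[OF vmin this] have "\<mu> \<le> (u \<bullet> (?L *v u)) / (norm u * norm u)"
      by (simp add: \<mu>_def matrix_vector_mult_scaleR)
    then show ?thesis using False by (simp add: field_simps power2_norm_eq_inner[symmetric] power2_eq_square)
  qed simp
  \<comment> \<open>Half the gradient at \<open>v\<close> of
    \<open>u \<bullet> (?L *v u) - \<mu> * (u \<bullet> u)\<close>, a form that is nonnegative on
    \<open>W\<close> and zero at \<open>v\<close>. Moving from \<open>v\<close> along
    \<open>- w\<close> stays in \<open>W\<close> and would decrease the form unless \<open>w\<close>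
    vanishes.\<close>
  define w where "w = ?L *v v - \<mu> *\<^sub>R v"
  have wW: "w \<in> W"
    unfolding w_def using v by (intro subspace_diff[OF subW] LW subspace_scale[OF subW]) simp
  have "0 \<le> - 2 * (w \<bullet> w) + \<theta> * (w \<bullet> (?L *v w) - \<mu> * (w \<bullet> w))" if \<theta>: "0 < \<theta>" for \<theta>
  proof -
    let ?u = "v - \<theta> *\<^sub>R w"
    have "?u \<in> W" using v by (intro subspace_diff[OF subW] wW subspace_scale[OF subW]) simp
    from ray[OF this] have "0 \<le> ?u \<bullet> (?L *v ?u) - \<mu> * (?u \<bullet> ?u)" by simp
    also have "v \<bullet> (?L *v w) = w \<bullet> (?L *v v)"
      by (rule trans[OF laplacian_symmetric[OF E] inner_commute])
    then have "?u \<bullet> (?L *v ?u) - \<mu> * (?u \<bullet> ?u) =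
        \<mu> - 2 * \<theta> * (w \<bullet> (?L *v v)) + \<theta> * \<theta> * (w \<bullet> (?L *v w))
        - \<mu> * (1 - 2 * \<theta> * (w \<bullet> v) + \<theta> * \<theta> * (w \<bullet> w))"
      by (simp add: matrix_vector_mult_diff_distrib matrix_vector_mult_scaleR inner_diff_left
          inner_diff_right vv \<mu>_def[symmetric] inner_commute[of v w] algebra_simps)
    also have "w \<bullet> (?L *v v) = w \<bullet> w + \<mu> * (w \<bullet> v)"
      by (simp add: w_def inner_diff_left inner_diff_right inner_commute algebra_simps)
    also have "\<mu> - 2 * \<theta> * (w \<bullet> w + \<mu> * (w \<bullet> v)) + \<theta> * \<theta> * (w \<bullet> (?L *v w))
        - \<mu> * (1 - 2 * \<theta> * (w \<bullet> v) + \<theta> * \<theta> * (w \<bullet> w))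
        = \<theta> * (- 2 * (w \<bullet> w) + \<theta> * (w \<bullet> (?L *v w) - \<mu> * (w \<bullet> w)))"
      by (simp add: algebra_simps)
    finally show ?thesis using \<theta> by (simp add: zero_le_mult_iff)
  qed
  then have "0 \<le> - 2 * (w \<bullet> w)"
  proof -
    assume *: "\<And>\<theta>. 0 < \<theta> \<Longrightarrow> 0 \<le> - 2 * (w \<bullet> w) + \<theta> * (w \<bullet> (?L *v w) - \<mu> * (w \<bullet> w))"
    have "((\<lambda>\<theta>. - 2 * (w \<bullet> w) + \<theta> * (w \<bullet> (?L *v w) - \<mu> * (w \<bullet> w))) \<longlongrightarrow>
        - 2 * (w \<bullet> w) + 0 * (w \<bullet> (?L *v w) - \<mu> * (w \<bullet> w))) (at_right 0)"
      by (intro tendsto_intros)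
    then have "0 \<le> - 2 * (w \<bullet> w) + 0 * (w \<bullet> (?L *v w) - \<mu> * (w \<bullet> w))"
      by (rule tendsto_lowerbound)
         (use * in \<open>auto simp: eventually_at_right_field intro!: exI[of _ 1]\<close>)
    then show ?thesis by simp
  qed
  then have "w \<bullet> w = 0" using inner_ge_zero[of w] by linarith
  then have "w = 0" by simp
  then have Lv: "?L *v v = \<mu> *s v" by (simp add: w_def scalar_mult_eq_scaleR)
  have v0: "v \<noteq> 0" using vv by auto
  have "\<mu> \<noteq> 0"
  proof
    assume "\<mu> = 0"
    then have "v = 0"
      using laplacian_form_eq_0_imp_constant[OF E con, of v] v
      by (intro constant_sum_0_imp_0) (auto simp: \<mu>_def W_def)
    then show False using v0 by simp
  qed
  then have \<mu>: "0 < \<mu>" using nonneg[of v] by (simp add: \<mu>_def)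
  let ?S = "{l. 0 < l \<and> (\<exists>v. v \<noteq> 0 \<and> ?L *v v = l *s v)}"
  have fin: "finite ?S"
    by (rule finite_subset[OF _ finite_eigenvalues_symmetric[OF laplacian_symmetric[OF E]]]) auto
  have mem: "\<mu> \<in> ?S" using \<mu> Lv v0 by blast
  have "\<sigma> \<in> ?S" unfolding \<sigma>_def min_pos_eigenvalue_def using fin mem by (intro Min_in) auto
  then show "0 < \<sigma>" by simp
  \<comment> \<open>\<open>\<mu>\<close> is one of the positive eigenvalues, so the gap inequality
    with \<open>\<mu>\<close> implies the one with their minimum.\<close>
  have "\<sigma> \<le> \<mu>" unfolding \<sigma>_def min_pos_eigenvalue_def using fin mem by (intro Min_le)
  then have "\<sigma> * (y \<bullet> y) \<le> \<mu> * (y \<bullet> y)" by (intro mult_right_mono) auto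
  moreover assume "(\<Sum>i\<in>UNIV. y $ i) = 0"
  then have "\<mu> * (y \<bullet> y) \<le> y \<bullet> (?L *v y)" by (intro ray) (simp add: W_def)
  ultimately show "\<sigma> * (norm y)\<^sup>2 \<le> y \<bullet> (?L *v y)" by (simp add: power2_norm_eq_inner)
qed

text \<open>The rank-one term in \<open>T\<close> removes the constants from the kernel, so
  \<open>T\<close> is bijective. Images under the Laplacian sum to zero; since \<open>q\<close> does
  too, the rank-one part vanishes at the preimage, where \<open>T\<close> acts as the
  Laplacian.\<close>

lemma laplacian_surj_mean_zero:
  fixes E :: "('v::{finite, linorder} \<times> 'v) set" and q :: "real ^ ('v::{finite, linorder})"
  assumes E: "edge_set E" and con: "connected_graph E" and q: "(\<Sum>i\<in>UNIV. q $ i) = 0"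
  shows "\<exists>y. laplacian E *v y = q \<and> (\<Sum>i\<in>UNIV. y $ i) = 0"
proof -
  let ?L = "laplacian E"
  define T where "T y = ?L *v y + (\<Sum>i\<in>UNIV. y $ i) *\<^sub>R (\<chi> i. 1)" for y :: "real ^ ('v::{finite, linorder})"
  have lin: "linear T"
    by (intro linearI)
       (auto simp: T_def matrix_vector_right_distrib matrix_vector_mult_scaleR sum.distrib
          sum_distrib_left[symmetric] algebra_simps)
  have "inj T"
    unfolding linear_injective_0[OF lin]
  proof (intro allI impI)
    fix y assume "T y = 0"
    then have "0 = y \<bullet> T y" by simp
    also have "\<dots> = y \<bullet> (?L *v y) + (\<Sum>i\<in>UNIV. y $ i) * (\<Sum>i\<in>UNIV. y $ i)"
      by (simp add: T_def inner_add_right) (simp add: inner_vec_def)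
    finally have "y \<bullet> (?L *v y) + (\<Sum>i\<in>UNIV. y $ i) * (\<Sum>i\<in>UNIV. y $ i) = 0" by simp
    moreover have "0 \<le> y \<bullet> (?L *v y)"
      by (auto simp: inner_laplacian[OF E] intro!: sum_nonneg)
    moreover have "0 \<le> (\<Sum>i\<in>UNIV. y $ i) * (\<Sum>i\<in>UNIV. y $ i)" by simp
    ultimately have "y \<bullet> (?L *v y) = 0" "(\<Sum>i\<in>UNIV. y $ i) * (\<Sum>i\<in>UNIV. y $ i) = 0"
      by linarith+
    then show "y = 0"
      using laplacian_form_eq_0_imp_constant[OF E con, of y] by (intro constant_sum_0_imp_0) auto
  qed
  then have "surj T" using linear_injective_imp_surjective[OF lin] by blast
  then obtain y where y: "T y = q" by (metis surjD)
  have "0 = (\<chi> i. 1) \<bullet> T y" using q y by (simp add: inner_vec_def)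
  also have "\<dots> = (\<chi> i. 1) \<bullet> (?L *v y) + (\<Sum>i\<in>UNIV. y $ i) * real CARD('v)"
    by (simp add: T_def inner_add_right) (simp add: inner_vec_def)
  also have "(\<chi> i. 1) \<bullet> (?L *v y) = 0" by (simp add: inner_laplacian[OF E])
  finally have "(\<Sum>i\<in>UNIV. y $ i) = 0" by simp
  with y show ?thesis by (intro exI[of _ y]) (simp add: T_def)
qed

text \<open>With \<open>R = y \<bullet> (?L *v y)\<close>, Cauchy-Schwarz gives
  \<open>R \<le> norm y * norm q\<close> and the gap gives
  \<open>?\<sigma> * (norm y)\<^sup>2 \<le> R\<close>. Squaring the first and cancelling one factor
  \<open>R\<close> leaves a single factor \<open>1 / ?\<sigma>\<close>.\<close>

lemma laplacian_dual_bound: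
  fixes E :: "('v::{finite, linorder} \<times> 'v) set" and q :: "real ^ ('v::{finite, linorder})"
  assumes E: "edge_set E" and con: "connected_graph E" and N: "2 \<le> CARD('v)"
    and q: "(\<Sum>i\<in>UNIV. q $ i) = 0"
  shows "\<exists>y. laplacian E *v y = q
    \<and> (\<Sum>(i, j)\<in>E. (y $ i - y $ j)\<^sup>2) \<le> (norm q)\<^sup>2 / min_pos_eigenvalue (laplacian E)"
proof -
  let ?L = "laplacian E" and ?\<sigma> = "min_pos_eigenvalue (laplacian E)"
  obtain y where y: "?L *v y = q" "(\<Sum>i\<in>UNIV. y $ i) = 0"
    using laplacian_surj_mean_zero[OF E con q] by blast
  define R where "R = y \<bullet> (?L *v y)"
  have R: "R = (\<Sum>(i, j)\<in>E. (y $ i - y $ j)\<^sup>2)"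
    by (simp add: R_def inner_laplacian[OF E] power2_eq_square)
  note gap = laplacian_spectral_gap[OF E con N]
  have R0: "0 \<le> R" unfolding R by (auto intro!: sum_nonneg)
  have "R \<le> norm y * norm q" unfolding R_def y(1) by (rule norm_cauchy_schwarz)
  then have "?\<sigma> * R\<^sup>2 \<le> ?\<sigma> * (norm y * norm q)\<^sup>2"
    using R0 gap(1) by (intro mult_left_mono power_mono) auto
  also have "\<dots> = (?\<sigma> * (norm y)\<^sup>2) * (norm q)\<^sup>2" by (simp add: power_mult_distrib)
  also have "\<dots> \<le> R * (norm q)\<^sup>2"
    unfolding R_def using gap(2)[OF y(2)] by (intro mult_right_mono) auto
  finally have "R * (?\<sigma> * R) \<le> R * (norm q)\<^sup>2" by (simp add: power2_eq_square algebra_simps)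
  then have "R = 0 \<or> ?\<sigma> * R \<le> (norm q)\<^sup>2" using R0 by (auto simp: mult_le_cancel_left)
  then have "?\<sigma> * R \<le> (norm q)\<^sup>2" by auto
  then have "R \<le> (norm q)\<^sup>2 / ?\<sigma>" using gap(1) by (simp add: field_simps)
  then show ?thesis using y(1) R by blast
qed

lemma power2_norm_vec_eq_sum: "(norm v)\<^sup>2 = (\<Sum>b\<in>UNIV. (v $ b)\<^sup>2)" for v :: "real ^ 'n"
  unfolding power2_norm_eq_inner by (simp add: inner_vec_def power2_eq_square)

text \<open>With the incidence matrix \<open>B\<close>, this solves \<open>B\<^sup>T B y = q\<close> coordinatewise.\<close>

lemma exists_dual_potential:
  fixes E :: "('v::{finite, linorder} \<times> 'v) set" and q :: "'v \<Rightarrow> real ^ 'n"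
  assumes E: "edge_set E" and con: "connected_graph E" and N: "2 \<le> CARD('v)"
    and q: "(\<Sum>i\<in>UNIV. q i) = 0"
  shows "\<exists>y. (\<forall>z. (\<Sum>i\<in>UNIV. q i \<bullet> z i) = (\<Sum>(i, j)\<in>E. (y i - y j) \<bullet> (z i - z j)))
    \<and> (\<Sum>(i, j)\<in>E. (norm (y i - y j))\<^sup>2)
      \<le> (\<Sum>i\<in>UNIV. (norm (q i))\<^sup>2) / min_pos_eigenvalue (laplacian E)"
proof -
  let ?\<sigma> = "min_pos_eigenvalue (laplacian E)"
  have "\<exists>Y. laplacian E *v Y = (\<chi> i. q i $ b)
      \<and> (\<Sum>(i, j)\<in>E. (Y $ i - Y $ j)\<^sup>2) \<le> (norm (\<chi> i. q i $ b))\<^sup>2 / ?\<sigma>" for b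
    using q by (intro laplacian_dual_bound[OF E con N]) (simp add: vec_eq_iff)
  then obtain Y where Y: "\<And>b. laplacian E *v Y b = (\<chi> i. q i $ b)"
    "\<And>b. (\<Sum>(i, j)\<in>E. (Y b $ i - Y b $ j)\<^sup>2) \<le> (norm (\<chi> i. q i $ b))\<^sup>2 / ?\<sigma>"
    by metis
  define y :: "'v \<Rightarrow> real ^ 'n" where "y i = (\<chi> b. Y b $ i)" for i
  have "(\<Sum>j\<in>nbrs E i. y i - y j) = q i" for i
    by (simp add: vec_eq_iff y_def laplacian_mult[OF E, symmetric] Y)
  then have "(\<Sum>i\<in>UNIV. q i \<bullet> z i) = (\<Sum>(i, j)\<in>E. (y i - y j) \<bullet> (z i - z j))" for z
    using sum_inner_nbrs[OF E, of "\<lambda>i j. y i - y j" z] by (simp add: inner_commute)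
  moreover have "(\<Sum>(i, j)\<in>E. (norm (y i - y j))\<^sup>2) \<le> (\<Sum>i\<in>UNIV. (norm (q i))\<^sup>2) / ?\<sigma>"
  proof -
    have "(\<Sum>(i, j)\<in>E. (norm (y i - y j))\<^sup>2) = (\<Sum>b\<in>UNIV. \<Sum>(i, j)\<in>E. (Y b $ i - Y b $ j)\<^sup>2)"
      unfolding case_prod_unfold
      by (subst sum.swap) (simp add: power2_norm_vec_eq_sum y_def)
    also have "\<dots> \<le> (\<Sum>b\<in>UNIV. (norm (\<chi> i. q i $ b))\<^sup>2 / ?\<sigma>)" by (intro sum_mono Y)
    also have "\<dots> = (\<Sum>b\<in>UNIV. \<Sum>i\<in>UNIV. (q i $ b)\<^sup>2) / ?\<sigma>"
      by (simp add: sum_divide_distrib power2_norm_vec_eq_sum)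
    also have "(\<Sum>b\<in>UNIV. \<Sum>i\<in>UNIV. (q i $ b)\<^sup>2) = (\<Sum>i\<in>UNIV. (norm (q i))\<^sup>2)"
      by (subst sum.swap) (simp add: power2_norm_vec_eq_sum)
    finally show ?thesis .
  qed
  ultimately show ?thesis by blast
qed

section \<open>Oracle noise\<close>

text \<open>\<^const>\<open>prob_space.indep_var\<close> requires both variables to have the same type, hence this
  formulation for images of a pair of independent variables.\<close>

lemma (in prob_space) indep_var_distr_pair:
  assumes ind: "indep_var S X T Y"
    and f: "f \<in> S \<rightarrow>\<^sub>M S'" and g: "g \<in> T \<rightarrow>\<^sub>M T'"
  shows "distr M (S' \<Otimes>\<^sub>M T') (\<lambda>\<omega>. (f (X \<omega>), g (Y \<omega>)))
    = distr M S' (\<lambda>\<omega>. f (X \<omega>)) \<Otimes>\<^sub>M distr M T' (\<lambda>\<omega>. g (Y \<omega>))"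
proof -
  have X: "X \<in> M \<rightarrow>\<^sub>M S" and Y: "Y \<in> M \<rightarrow>\<^sub>M T"
    and joint: "distr M (S \<Otimes>\<^sub>M T) (\<lambda>\<omega>. (X \<omega>, Y \<omega>)) = distr M S X \<Otimes>\<^sub>M distr M T Y"
    using ind unfolding indep_var_distribution_eq by auto
  note [measurable] = X Y f g
  have fX: "distr M S' (\<lambda>\<omega>. f (X \<omega>)) = distr (distr M S X) S' f"
    by (simp add: distr_distr comp_def)
  have gY: "distr M T' (\<lambda>\<omega>. g (Y \<omega>)) = distr (distr M T Y) T' g"
    by (simp add: distr_distr comp_def)
  interpret gY: prob_space "distr (distr M T Y) T' g"
    unfolding gY[symmetric] by (rule prob_space_distr) simp
  have "distr (distr M S X) S' f \<Otimes>\<^sub>M distr (distr M T Y) T' g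
      = distr (distr M S X \<Otimes>\<^sub>M distr M T Y) (S' \<Otimes>\<^sub>M T') (\<lambda>(x, y). (f x, g y))"
    by (rule pair_measure_distr) (simp_all add: gY.sigma_finite_measure_axioms)
  also have "\<dots> = distr M (S' \<Otimes>\<^sub>M T') (\<lambda>\<omega>. (f (X \<omega>), g (Y \<omega>)))"
    unfolding joint[symmetric] by (simp add: distr_distr comp_def)
  finally show ?thesis unfolding fX gY ..
qed

text \<open>The oracle property speaks of fixed points in \<open>U\<close>. The product form of the
  joint law permits integrating over the fresh noise first, with the point frozen, and then over the
  point. The bound on \<open>X - a\<close> makes the inner product integrable, given a second moment
  of the error.\<close>

lemma (in prob_space) sfo_noise:
  fixes X :: "'a \<Rightarrow> 'b::euclidean_space" and Y :: "'a \<Rightarrow> 'x" and f :: "'b \<Rightarrow> real"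
  assumes X[measurable]: "X \<in> borel_measurable M" and Y[measurable]: "Y \<in> M \<rightarrow>\<^sub>M D"
    and indep: "distr M (borel \<Otimes>\<^sub>M D) (\<lambda>\<omega>. (X \<omega>, Y \<omega>)) = distr M borel X \<Otimes>\<^sub>M distr M D Y"
    and distrY: "distr M D Y = D"
    and sfo: "sfo D f df U \<sigma> G" and cont: "continuous_on U df"
    and XU: "\<And>\<omega>. \<omega> \<in> space M \<Longrightarrow> X \<omega> \<in> U"
    and bd: "\<And>\<omega>. \<omega> \<in> space M \<Longrightarrow> norm (X \<omega> - a) \<le> R"
  defines "\<Delta> \<equiv> \<lambda>\<omega>. G (X \<omega>) (Y \<omega>) - df (X \<omega>)"
  shows "integrable M (\<lambda>\<omega>. (norm (\<Delta> \<omega>))\<^sup>2)" "expectation (\<lambda>\<omega>. (norm (\<Delta> \<omega>))\<^sup>2) \<le> \<sigma>\<^sup>2"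
    "integrable M (\<lambda>\<omega>. \<Delta> \<omega> \<bullet> (X \<omega> - a))" "expectation (\<lambda>\<omega>. \<Delta> \<omega> \<bullet> (X \<omega> - a)) = 0"
proof -
  define \<mu> where "\<mu> = distr M borel X"
  interpret \<mu>: prob_space \<mu> unfolding \<mu>_def by (rule prob_space_distr) simp
  interpret D: prob_space D using prob_space_distr[OF Y] distrY by simp
  interpret PP: pair_prob_space \<mu> D ..
  have joint: "distr M (borel \<Otimes>\<^sub>M D) (\<lambda>\<omega>. (X \<omega>, Y \<omega>)) = \<mu> \<Otimes>\<^sub>M D"
    using indep distrY unfolding \<mu>_def by simp
  have setsJ[measurable_cong]: "sets \<mu> = sets borel" by (simp add: \<mu>_def)
  have Uopen: "open U" using sfo by (simp add: sfo_def)
  have U[measurable]: "U \<in> sets borel" using Uopen by simp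
  have G[measurable]: "(\<lambda>(x, y). G x y) \<in> borel_measurable (borel \<Otimes>\<^sub>M D)"
    using sfo by (simp add: sfo_def)
  have int: "integrable D (G x)" and mean: "(\<integral>y. G x y \<partial>D) = df x"
    and second: "(\<integral>\<^sup>+y. ennreal ((norm (G x y - df x))\<^sup>2) \<partial>D) \<le> ennreal (\<sigma>\<^sup>2)" if "x \<in> U" for x
    using sfo that by (auto simp: sfo_def)
  \<comment> \<open>\<open>df\<close> is controlled only on \<open>U\<close>; set to zero outside,
    it becomes Borel measurable on the whole space.\<close>
  define d where "d x = indicator U x *\<^sub>R df x" for x
  have d[measurable]: "d \<in> borel_measurable borel"
    unfolding d_def using borel_measurable_continuous_on_indicator[OF U cont] .
  define H where "H = (\<lambda>(x, y). G x y - d x)"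
  have H[measurable]: "H \<in> borel_measurable (borel \<Otimes>\<^sub>M D)"
  proof -
    have "(\<lambda>p. (case p of (x, y) \<Rightarrow> G x y) - d (fst p)) \<in> borel_measurable (borel \<Otimes>\<^sub>M D)"
      by measurable
    then show ?thesis by (simp add: H_def case_prod_unfold)
  qed
  have H\<Delta>: "\<Delta> \<omega> = H (X \<omega>, Y \<omega>)" if "\<omega> \<in> space M" for \<omega>
    using XU[OF that] by (simp add: \<Delta>_def H_def d_def)
  have AE_U: "AE x in \<mu>. x \<in> U"
    unfolding \<mu>_def by (subst AE_distr_iff) (use XU in \<open>auto simp: pred_def[symmetric]\<close>)
  have nn: "(\<integral>\<^sup>+\<omega>. ennreal ((norm (\<Delta> \<omega>))\<^sup>2) \<partial>M) \<le> ennreal (\<sigma>\<^sup>2)"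
  proof -
    have "(\<integral>\<^sup>+\<omega>. ennreal ((norm (\<Delta> \<omega>))\<^sup>2) \<partial>M) = (\<integral>\<^sup>+\<omega>. ennreal ((norm (H (X \<omega>, Y \<omega>)))\<^sup>2) \<partial>M)"
      by (intro nn_integral_cong) (simp add: H\<Delta>)
    also have "\<dots> = (\<integral>\<^sup>+p. ennreal ((norm (H p))\<^sup>2) \<partial>(\<mu> \<Otimes>\<^sub>M D))"
      unfolding joint[symmetric] by (subst nn_integral_distr) simp_all
    also have "\<dots> = (\<integral>\<^sup>+x. \<integral>\<^sup>+y. ennreal ((norm (H (x, y)))\<^sup>2) \<partial>D \<partial>\<mu>)"
      by (subst D.nn_integral_fst[symmetric]) simp_all
    also have "\<dots> \<le> (\<integral>\<^sup>+x. ennreal (\<sigma>\<^sup>2) \<partial>\<mu>)"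
    proof (intro nn_integral_mono_AE)
      show "AE x in \<mu>. (\<integral>\<^sup>+y. ennreal ((norm (H (x, y)))\<^sup>2) \<partial>D) \<le> ennreal (\<sigma>\<^sup>2)"
        using AE_U
      proof eventually_elim
        case (elim x)
        then show ?case using second[OF elim] by (simp add: H_def d_def)
      qed
    qed
    also have "\<dots> = ennreal (\<sigma>\<^sup>2)" by (simp add: \<mu>.emeasure_space_1)
    finally show ?thesis .
  qed
  have \<Delta>m: "\<Delta> \<in> borel_measurable M"
  proof -
    have "(\<lambda>\<omega>. H (X \<omega>, Y \<omega>)) \<in> borel_measurable M" by measurable
    then show ?thesis by (subst measurable_cong[OF H\<Delta>])
  qed
  note [measurable] = \<Delta>m
  show i2: "integrable M (\<lambda>\<omega>. (norm (\<Delta> \<omega>))\<^sup>2)"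
  proof (rule integrableI_bounded)
    show "(\<integral>\<^sup>+\<omega>. ennreal (norm ((norm (\<Delta> \<omega>))\<^sup>2)) \<partial>M) < \<infinity>"
      using le_less_trans[OF nn ennreal_less_top] by simp
  qed simp
  show "expectation (\<lambda>\<omega>. (norm (\<Delta> \<omega>))\<^sup>2) \<le> \<sigma>\<^sup>2"
    using nn by (subst (asm) nn_integral_eq_integral[OF i2]) auto
  have R0: "0 \<le> R"
    using not_empty bd norm_ge_zero order_trans by (metis all_not_in_conv)
  show i1: "integrable M (\<lambda>\<omega>. \<Delta> \<omega> \<bullet> (X \<omega> - a))"
  \<comment> \<open>Cauchy-Schwarz with \<open>norm (\<Delta> \<omega>) \<le> 1 + (norm (\<Delta>
    \<omega>))\<^sup>2\<close> reduces integrability to the second moment.\<close>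
  proof (rule Bochner_Integration.integrable_bound[where f = "\<lambda>\<omega>. (1 + (norm (\<Delta> \<omega>))\<^sup>2) * R"])
    show "integrable M (\<lambda>\<omega>. (1 + (norm (\<Delta> \<omega>))\<^sup>2) * R)"
      using i2 by (intro integrable_mult_left Bochner_Integration.integrable_add) auto
    show "AE \<omega> in M. norm (\<Delta> \<omega> \<bullet> (X \<omega> - a)) \<le> norm ((1 + (norm (\<Delta> \<omega>))\<^sup>2) * R)"
    proof (rule AE_I2)
      fix \<omega> assume \<omega>: "\<omega> \<in> space M"
      have "2 * norm (\<Delta> \<omega>) \<le> 1 + (norm (\<Delta> \<omega>))\<^sup>2"
        using zero_le_power2[of "norm (\<Delta> \<omega>) - 1"] by (simp add: power2_eq_square algebra_simps)
      then have le: "norm (\<Delta> \<omega>) \<le> 1 + (norm (\<Delta> \<omega>))\<^sup>2"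
        using norm_ge_zero[of "\<Delta> \<omega>"] by linarith
      have "norm (\<Delta> \<omega> \<bullet> (X \<omega> - a)) \<le> norm (\<Delta> \<omega>) * norm (X \<omega> - a)"
        using Cauchy_Schwarz_ineq2 by simp
      also have "\<dots> \<le> (1 + (norm (\<Delta> \<omega>))\<^sup>2) * R"
        using le bd[OF \<omega>] by (intro mult_mono) auto
      also have "\<dots> \<le> norm ((1 + (norm (\<Delta> \<omega>))\<^sup>2) * R)" by simp
      finally show "norm (\<Delta> \<omega> \<bullet> (X \<omega> - a)) \<le> norm ((1 + (norm (\<Delta> \<omega>))\<^sup>2) * R)" .
    qed
  qed measurable
  have cong: "\<Delta> \<omega> \<bullet> (X \<omega> - a) = H (X \<omega>, Y \<omega>) \<bullet> (fst (X \<omega>, Y \<omega>) - a)" if "\<omega> \<in> space M" for \<omega>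
    using H\<Delta>[OF that] by simp
  have XY: "(\<lambda>\<omega>. (X \<omega>, Y \<omega>)) \<in> measurable M (borel \<Otimes>\<^sub>M D)" by measurable
  have Hm: "(\<lambda>p. H p \<bullet> (fst p - a)) \<in> borel_measurable (borel \<Otimes>\<^sub>M D)" by measurable
  have iJ: "integrable (\<mu> \<Otimes>\<^sub>M D) (\<lambda>p. H p \<bullet> (fst p - a))"
    unfolding joint[symmetric] integrable_distr_eq[OF XY Hm]
    using i1 by (subst Bochner_Integration.integrable_cong[OF refl cong[symmetric]]) auto
  have "expectation (\<lambda>\<omega>. \<Delta> \<omega> \<bullet> (X \<omega> - a)) = expectation (\<lambda>\<omega>. H (X \<omega>, Y \<omega>) \<bullet> (fst (X \<omega>, Y \<omega>) - a))"
    by (intro Bochner_Integration.integral_cong refl cong)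
  also have "\<dots> = (\<integral>p. H p \<bullet> (fst p - a) \<partial>(\<mu> \<Otimes>\<^sub>M D))"
    unfolding joint[symmetric] integral_distr[OF XY Hm] ..
  also have "\<dots> = (\<integral>x. \<integral>y. H (x, y) \<bullet> (x - a) \<partial>D \<partial>\<mu>)"
    using PP.integral_fst'[OF iJ] by simp
  also have "\<dots> = (\<integral>x. 0 \<partial>\<mu>)"
  proof (rule integral_cong_AE)
    show "AE x in \<mu>. (\<integral>y. H (x, y) \<bullet> (x - a) \<partial>D) = 0"
      using AE_U
    proof eventually_elim
      case (elim x)
      have "(\<integral>y. H (x, y) \<bullet> (x - a) \<partial>D) = (\<integral>y. G x y - df x \<partial>D) \<bullet> (x - a)"
        using elim int[OF elim]
        by (simp add: H_def d_def integral_inner_left del: Bochner_Integration.integral_diff)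
      also have "\<dots> = 0"
        using int[OF elim] mean[OF elim] by (simp add: D.prob_space)
      finally show ?case .
    qed
  qed measurable
  finally show "expectation (\<lambda>\<omega>. \<Delta> \<omega> \<bullet> (X \<omega> - a)) = 0" by simp
qed

section \<open>Pathwise analysis\<close>

text \<open>\<open>v\<close> is the noisy gradient and \<open>w\<close> the coupling term. The
  curvature \<open>1 / c\<close> is divided among the descent lemma (\<open>L\<close>), a reserve
  left to the caller (\<open>b\<close>) and Young's inequality for the noise
  (\<open>a\<close>).\<close>

lemma prox_gradient_step:
  fixes \<phi> :: "'a::euclidean_space \<Rightarrow> ereal" and f :: "'a \<Rightarrow> real"
  assumes \<phi>: "closed_convex \<phi>" "\<And>z. \<phi> z \<noteq> - \<infinity>" "bounded (edom \<phi>)" and c: "0 < c"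
    and z: "z \<in> edom \<phi>"
    and f: "convex_on UNIV f" and grad: "\<And>z. z \<in> U \<Longrightarrow> GDERIV f z :> df z"
    and lip: "L-lipschitz_on U df"
    and a: "0 < a" and La: "L + b + a \<le> 1 / c"
    and y: "y = prox (\<lambda>z. ereal c * \<phi> z) (x - c *\<^sub>R (v + w))"
    and seg: "closed_segment x y \<subseteq> U"
  shows "(real_of_ereal (\<phi> y) + f y) - (real_of_ereal (\<phi> z) + f z) + w \<bullet> (y - z)
    \<le> (1 / c) / 2 * ((norm (z - x))\<^sup>2 - (norm (z - y))\<^sup>2) - b / 2 * (norm (y - x))\<^sup>2
      + (- ((v - df x) \<bullet> (x - z)) + (norm (v - df x))\<^sup>2 / (2 * a))"
proof -
  define \<Delta> where "\<Delta> = v - df x"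
  define d where "d = y - x"
  have xU: "x \<in> U" using seg by auto
  have ne: "edom \<phi> \<noteq> {}" using z by blast
  have "c * (real_of_ereal (\<phi> y) - real_of_ereal (\<phi> z)) \<le> (y - (x - c *\<^sub>R (v + w))) \<bullet> (z - y)"
    unfolding y by (rule prox_variational[OF \<phi> ne c z])
  also have "\<dots> = c * ((1 / c) * ((y - x) \<bullet> (z - y)) + (v + w) \<bullet> (z - y))"
    using c by (simp add: inner_diff_left inner_add_left distrib_left)
  finally have prox: "real_of_ereal (\<phi> y) - real_of_ereal (\<phi> z)
      \<le> (1 / c) * ((y - x) \<bullet> (z - y)) + (v + w) \<bullet> (z - y)"
    using c by (simp only: mult_le_cancel_left_pos)
  have three: "(y - x) \<bullet> (z - y) = ((norm (z - x))\<^sup>2 - (norm (z - y))\<^sup>2 - (norm d)\<^sup>2) / 2"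
    unfolding power2_norm_eq_inner d_def
    by (simp add: inner_diff_left inner_diff_right inner_commute)
  have descent: "f y \<le> f x + df x \<bullet> (y - x) + L / 2 * (norm d)\<^sup>2"
    unfolding d_def by (rule descent_inequality[OF seg grad lip])
  have below: "f x + df x \<bullet> (z - x) \<le> f z"
    by (rule convex_gradient_inequality[OF f grad[OF xU]])
  have young: "- (\<Delta> \<bullet> d) \<le> (norm \<Delta>)\<^sup>2 / (2 * a) + a / 2 * (norm d)\<^sup>2"
  proof -
    have "0 \<le> (norm (\<Delta> + a *\<^sub>R d))\<^sup>2 / (2 * a)" using a by simp
    also have "\<dots> = (norm \<Delta>)\<^sup>2 / (2 * a) + a / 2 * (norm d)\<^sup>2 + \<Delta> \<bullet> d"
      using a by (simp only: norm_add_scaleR_power2) (simp add: field_simps power2_eq_square)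
    finally show ?thesis by simp
  qed
  have "(L + b + a) * (norm d)\<^sup>2 \<le> (1 / c) * (norm d)\<^sup>2"
    using La by (intro mult_right_mono) auto
  then have curv: "(L + b + a) / 2 * (norm d)\<^sup>2 \<le> (1 / c) / 2 * (norm d)\<^sup>2" by simp
  \<comment> \<open>\<open>y\<close> depends on the noise, so \<open>\<Delta>\<close> must not stay
    paired with \<open>y - z\<close>. It is split into the pairing with \<open>x - z\<close>, which
    will have mean zero, and the pairing with \<open>d\<close>, which Young's inequality
    absorbs.\<close>
  have split: "(v + w) \<bullet> (z - y) = - (\<Delta> \<bullet> (x - z)) - \<Delta> \<bullet> d - df x \<bullet> (y - x) + df x \<bullet> (z - x) - w \<bullet> (y - z)"
    by (simp add: \<Delta>_def d_def inner_diff_left inner_diff_right inner_add_left)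
  have "(1 / c) * ((y - x) \<bullet> (z - y))
      = (1 / c) / 2 * ((norm (z - x))\<^sup>2 - (norm (z - y))\<^sup>2) - (1 / c) / 2 * (norm d)\<^sup>2"
    unfolding three by (simp add: algebra_simps add_divide_distrib diff_divide_distrib)
  then show ?thesis
    using prox descent below young curv
    unfolding split d_def[symmetric] \<Delta>_def[symmetric] by (simp add: distrib_right add_divide_distrib)
qed

text \<open>The deterministic part of the problem, to be used for one noise realisation at a time.
  \<open>z\<close> is the comparison point, later the solution. \<open>U i\<close> may fail to be
  convex and \<open>x0 i\<close> may lie outside the domain, hence the assumption on
  segments.\<close>

locale sdpga_problem =
  fixes E :: "('v::{finite, linorder} \<times> 'v) set"
    and \<xi> :: "'v \<Rightarrow> 'a::euclidean_space \<Rightarrow> ereal"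
    and f :: "'v \<Rightarrow> 'a \<Rightarrow> real" and df :: "'v \<Rightarrow> 'a \<Rightarrow> 'a" and U :: "'v \<Rightarrow> 'a set"
    and L \<gamma> c :: "'v \<Rightarrow> real" and ck :: "'v \<Rightarrow> nat \<Rightarrow> real" and D :: real
    and x0 :: "'v \<Rightarrow> 'a" and z :: 'a
  assumes edge_set: "edge_set E"
    and xi: "\<And>i. closed_convex (\<xi> i)" "\<And>i z. \<xi> i z \<noteq> - \<infinity>"
    and bounded_dom: "\<And>i. bounded (edom (\<xi> i))"
    and f_convex: "\<And>i. convex_on UNIV (f i)"
    and dom_in_U: "\<And>i. edom (\<xi> i) \<subseteq> U i"
    and x0_in_U: "\<And>i z. z \<in> edom (\<xi> i) \<Longrightarrow> closed_segment (x0 i) z \<subseteq> U i"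
    and gradient: "\<And>i z. z \<in> U i \<Longrightarrow> GDERIV (f i) z :> df i z"
    and lipschitz: "\<And>i. (L i)-lipschitz_on (U i) (df i)"
    and gamma: "\<And>i. 0 < \<gamma> i"
    and c_pos: "\<And>i. 0 < c i" and c: "\<And>i. L i + \<gamma> i * real (card (nbrs E i)) + 1 \<le> 1 / c i"
    and ck: "\<And>i k. 1 / ck i k = 1 / c i + sqrt (real k)"
    and D: "\<And>i. diameter (edom (\<xi> i)) \<le> D"
    and z_dom: "\<And>i. z \<in> edom (\<xi> i)"
begin

definition obj :: "'v \<Rightarrow> 'a \<Rightarrow> real" where
  "obj i y = real_of_ereal (\<xi> i y) + f i y"

definition weight :: "'v \<Rightarrow> 'v \<Rightarrow> real" where
  "weight i j = \<gamma> i * \<gamma> j / (\<gamma> i + \<gamma> j)"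

text \<open>What the noise contributes in step \<open>k\<close> at node \<open>i\<close>. The
  parameter \<open>1 + sqrt (real k)\<close> is the curvature available in \<open>1 / ck i k\<close>
  beyond \<open>L i\<close> and \<open>\<gamma> i * d_i\<close>.\<close>

definition noise :: "('v \<Rightarrow> 'a \<Rightarrow> 'x \<Rightarrow> 'a) \<Rightarrow> ('v \<Rightarrow> nat \<Rightarrow> 'x) \<Rightarrow> (nat \<Rightarrow> 'v \<Rightarrow> 'a) \<Rightarrow> nat \<Rightarrow> 'v \<Rightarrow> real" where
  "noise G v x k i = - ((G i (x k i) (v i k) - df i (x k i)) \<bullet> (x k i - z))
     + (norm (G i (x k i) (v i k) - df i (x k i)))\<^sup>2 / (2 * (1 + sqrt (real k)))"

lemma weight_pos: "0 < weight i j"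
  using gamma[of i] gamma[of j] by (simp add: weight_def)

lemma weight_commute: "weight i j = weight j i"
  by (simp add: weight_def mult.commute add.commute)

text \<open>Identifies \<open>Q\<close> as the inverse of the weight matrix.\<close>

lemma inverse_weight: "1 / weight i j = 1 / \<gamma> i + 1 / \<gamma> j"
  using gamma[of i] gamma[of j] by (simp add: weight_def field_simps)

text \<open>After multiplication by \<open>\<gamma> i + \<gamma> j\<close> the two sides differ by
  the square of \<open>norm (\<gamma> i *\<^sub>R a + \<gamma> j *\<^sub>R b)\<close>. The harmonic
  form of the weights is used here: an edge costs each endpoint only its own
  \<open>\<gamma>\<close>.\<close>

lemma weight_norm_diff_le: "weight i j * (norm (a - b))\<^sup>2 \<le> \<gamma> i * (norm a)\<^sup>2 + \<gamma> j * (norm b)\<^sup>2"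
  for a b :: 'a
proof -
  have pos: "0 < \<gamma> i + \<gamma> j" using gamma[of i] gamma[of j] by simp
  have "(\<gamma> i + \<gamma> j) * (\<gamma> i * (norm a)\<^sup>2 + \<gamma> j * (norm b)\<^sup>2) - \<gamma> i * \<gamma> j * (norm (a - b))\<^sup>2
      = (norm (\<gamma> i *\<^sub>R a + \<gamma> j *\<^sub>R b))\<^sup>2"
    unfolding power2_norm_eq_inner
    by (simp add: inner_diff_left inner_diff_right inner_add_left inner_add_right inner_commute
        algebra_simps)
  also have "\<dots> \<ge> 0" by simp
  finally show ?thesis using pos by (simp add: weight_def pos_divide_le_eq mult.commute)
qed

lemma ck_pos: "0 < ck i k"
proof -
  have "0 < 1 / c i + sqrt (real k)" using c_pos[of i] by (intro add_pos_nonneg) auto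
  then show ?thesis using ck[of i k] by (metis zero_less_divide_1_iff)
qed

lemma norm_diff_le_D: "y \<in> edom (\<xi> i) \<Longrightarrow> norm (z - y) \<le> D"
  using diameter_bounded_bound[OF bounded_dom z_dom, of y i] D[of i] by (simp add: dist_norm)

lemma convex_on_obj: "convex_on (edom (\<xi> i)) (obj i)"
  unfolding obj_def
  using convex_on_real_of_closed_convex[OF xi] f_convex convex_edom[OF xi]
  by (intro convex_on_add) (auto intro: convex_on_subset)

text \<open>The rows of \<open>\<Gamma>\<close> sum to zero, so only differences to neighbours
  remain.\<close>

lemma Gamma_sum:
  "(\<Sum>j\<in>nbrs E i \<union> {i}. (Gamma_mat E \<gamma> $ i $ j) *\<^sub>R y j) = (\<Sum>j\<in>nbrs E i. weight i j *\<^sub>R (y i - y j))"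
  for y :: "'v \<Rightarrow> 'a"
proof -
  have i: "i \<notin> nbrs E i" by (rule nbrs_irrefl[OF edge_set])
  have "(\<Sum>j\<in>nbrs E i \<union> {i}. (Gamma_mat E \<gamma> $ i $ j) *\<^sub>R y j)
      = (Gamma_mat E \<gamma> $ i $ i) *\<^sub>R y i + (\<Sum>j\<in>nbrs E i. (Gamma_mat E \<gamma> $ i $ j) *\<^sub>R y j)"
    using i by simp
  also have "(\<Sum>j\<in>nbrs E i. (Gamma_mat E \<gamma> $ i $ j) *\<^sub>R y j) = (\<Sum>j\<in>nbrs E i. - (weight i j *\<^sub>R y j))"
    using i by (intro sum.cong) (auto simp: Gamma_mat_def weight_def)
  also have "(Gamma_mat E \<gamma> $ i $ i) *\<^sub>R y i = (\<Sum>j\<in>nbrs E i. weight i j *\<^sub>R y i)"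
    by (simp add: Gamma_mat_def weight_def scaleR_sum_left)
  finally show ?thesis
    by (simp add: sum.distrib[symmetric] scaleR_diff_right)
qed

text \<open>Summation by parts. \<open>B\<close> bounds \<open>A\<close> only from index 1 on;
  \<open>A 0\<close> keeps the coefficient \<open>\<alpha> / 2\<close> since
  \<open>sqrt 0 = 0\<close>. This accommodates a starting point outside the domain.\<close>

lemma telescope_sqrt:
  fixes A :: "nat \<Rightarrow> real"
  assumes "\<And>k. A (Suc k) \<le> B"
  shows "(\<Sum>k<t. (\<alpha> + sqrt (real k)) / 2 * (A k - A (Suc k)))
    \<le> \<alpha> / 2 * A 0 + sqrt (real t) / 2 * B - (\<alpha> + sqrt (real t)) / 2 * A t"
proof (induction t)
  case (Suc t)
  \<comment> \<open>The growth of the coefficient from \<open>t\<close> to \<open>Suc t\<close> is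
    charged to \<open>B\<close>.\<close>
  have "0 \<le> (sqrt (real (Suc t)) - sqrt (real t)) / 2 * (B - A (Suc t))"
    using assms[of t] by (intro mult_nonneg_nonneg) auto
  with Suc show ?case by (simp add: algebra_simps add_divide_distrib diff_divide_distrib)
qed simp

text \<open>The edge multipliers \<open>weight i j * (\<Sum>l\<le>k. x l i - x l j)\<close> perform dual ascent. Here \<open>a\<close> is the
  accumulated edge difference, \<open>b\<close> the current and \<open>y\<close> the next one.\<close>

lemma dual_ascent_edge:
  fixes a b y u :: 'a
  assumes w: "0 < w"
  shows "u \<bullet> y + (1 / w / 2 * (norm (w *\<^sub>R (a + y) - u))\<^sup>2 - 1 / w / 2 * (norm (w *\<^sub>R a - u))\<^sup>2)
    \<le> (w *\<^sub>R (a + b)) \<bullet> y + w * (norm (y - b))\<^sup>2 / 2"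
proof -
  have "w *\<^sub>R (a + y) - u = (w *\<^sub>R a - u) + w *\<^sub>R y" by (simp add: algebra_simps)
  then have "1 / w / 2 * (norm (w *\<^sub>R (a + y) - u))\<^sup>2 - 1 / w / 2 * (norm (w *\<^sub>R a - u))\<^sup>2
      = (w *\<^sub>R a - u) \<bullet> y + w / 2 * (norm y)\<^sup>2"
    using w by (simp only: norm_add_scaleR_power2) (simp add: field_simps power2_eq_square)
  moreover have "w * (norm (y - b))\<^sup>2 / 2 = w / 2 * (norm y)\<^sup>2 + w / 2 * (norm b)\<^sup>2 - w * (b \<bullet> y)"
    unfolding power2_norm_eq_inner
    by (simp add: inner_diff_left inner_diff_right inner_commute algebra_simps add_divide_distrib
        diff_divide_distrib)
  moreover have "0 \<le> w / 2 * (norm b)\<^sup>2" using w by simp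
  moreover have "(w *\<^sub>R (a + b)) \<bullet> y = w * (a \<bullet> y) + w * (b \<bullet> y)"
    "(w *\<^sub>R a - u) \<bullet> y = w * (a \<bullet> y) - u \<bullet> y"
    by (simp_all add: inner_diff_left inner_add_left distrib_left)
  ultimately show ?thesis by linarith
qed

section \<open>One realisation of the algorithm\<close>

context
  fixes G :: "'v \<Rightarrow> 'a \<Rightarrow> 'x \<Rightarrow> 'a" and v :: "'v \<Rightarrow> nat \<Rightarrow> 'x" and x s p :: "nat \<Rightarrow> 'v \<Rightarrow> 'a"
  assumes run: "sdpga E \<gamma> \<xi> G ck x0 v x s p"
begin

lemma x_Suc: "x (Suc k) i = prox (\<lambda>y. ereal (ck i k) * \<xi> i y)
    (x k i - ck i k *\<^sub>R (G i (x k i) (v i k) + (p k i + s k i)))"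
  using run by (simp add: sdpga_def add.assoc)

lemma x_0: "x 0 i = x0 i"
  using run by (simp add: sdpga_def)

lemma x_Suc_dom: "x (Suc k) i \<in> edom (\<xi> i)"
  unfolding x_Suc using z_dom[of i] by (intro prox_in_edom xi bounded_dom ck_pos) auto

text \<open>The first step may start outside the domain and relies on the assumption about
  \<open>x0\<close>; afterwards both ends lie in the convex domain.\<close>

lemma x_seg: "closed_segment (x k i) (x (Suc k) i) \<subseteq> U i"
proof (cases k)
  case 0
  then show ?thesis using x0_in_U[OF x_Suc_dom] x_0 by simp
next
  case (Suc l)
  have "closed_segment (x k i) (x (Suc k) i) \<subseteq> edom (\<xi> i)"
    unfolding Suc by (rule closed_segment_subset[OF x_Suc_dom x_Suc_dom convex_edom[OF xi]])
  then show ?thesis using dom_in_U by blast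
qed

lemma x_in_U: "x k i \<in> U i"
  using x_seg by auto

lemma s_eq: "s k i = (\<Sum>j\<in>nbrs E i. weight i j *\<^sub>R (x k i - x k j))"
  using run by (cases k) (simp_all only: sdpga_def Gamma_sum)

text \<open>Starts at 1, since \<open>p\<close> is zero initially and accumulates \<open>s\<close>
  from index 1 on. The averages in the theorem use the same range.\<close>

definition iterate_sum :: "nat \<Rightarrow> 'v \<Rightarrow> 'a" where
  "iterate_sum k i = (\<Sum>l=1..k. x l i)"

lemma iterate_sum_Suc: "iterate_sum (Suc k) i = iterate_sum k i + x (Suc k) i"
  by (simp add: iterate_sum_def)

lemma p_eq: "p k i = (\<Sum>j\<in>nbrs E i. weight i j *\<^sub>R (iterate_sum k i - iterate_sum k j))"
proof (induction k)
  case 0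
  then show ?case using run by (simp add: sdpga_def iterate_sum_def)
next
  case (Suc k)
  have "p (Suc k) i = p k i + s (Suc k) i" using run by (simp add: sdpga_def)
  also have "\<dots> = (\<Sum>j\<in>nbrs E i. weight i j *\<^sub>R (iterate_sum k i - iterate_sum k j) + weight i j *\<^sub>R (x (Suc k) i - x (Suc k) j))"
    by (simp only: Suc s_eq sum.distrib)
  also have "\<dots> = (\<Sum>j\<in>nbrs E i. weight i j *\<^sub>R (iterate_sum (Suc k) i - iterate_sum (Suc k) j))"
    by (intro sum.cong refl) (simp add: iterate_sum_Suc algebra_simps)
  finally show ?case .
qed

text \<open>Summation by parts; \<open>z\<close> disappears because the same point at all nodes has
  no edge differences.\<close>

lemma coupling_sum:
  "(\<Sum>i\<in>UNIV. (p k i + s k i) \<bullet> (y i - z))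
    = (\<Sum>(i, j)\<in>E. (weight i j *\<^sub>R (iterate_sum k i - iterate_sum k j + (x k i - x k j))) \<bullet> (y i - y j))"
proof -
  have "p k i + s k i = (\<Sum>j\<in>nbrs E i. weight i j *\<^sub>R (iterate_sum k i - iterate_sum k j + (x k i - x k j)))" for i
    unfolding p_eq s_eq by (simp add: sum.distrib[symmetric] scaleR_add_right)
  then have "(\<Sum>i\<in>UNIV. (p k i + s k i) \<bullet> (y i - z))
      = (\<Sum>i\<in>UNIV. (y i - z) \<bullet> (\<Sum>j\<in>nbrs E i. weight i j *\<^sub>R (iterate_sum k i - iterate_sum k j + (x k i - x k j))))"
    by (simp only: inner_commute)
  also have "\<dots> = (\<Sum>(i, j)\<in>E. ((y i - z) - (y j - z)) \<bullet> (weight i j *\<^sub>R (iterate_sum k i - iterate_sum k j + (x k i - x k j))))"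
  proof (rule sum_inner_nbrs[OF edge_set])
    fix i j
    have "iterate_sum k j - iterate_sum k i + (x k j - x k i) = - (iterate_sum k i - iterate_sum k j + (x k i - x k j))" by simp
    then show "weight j i *\<^sub>R (iterate_sum k j - iterate_sum k i + (x k j - x k i))
        = - (weight i j *\<^sub>R (iterate_sum k i - iterate_sum k j + (x k i - x k j)))"
      by (simp only: weight_commute[of j i] scaleR_minus_right)
  qed
  finally show ?thesis by (simp add: inner_commute)
qed

text \<open>Half the squared distance from the multipliers to \<open>u\<close> in the norm of
  \<open>W^{-1}\<close>: the potential function of dual ascent with step \<open>W\<close>.\<close>

definition dual_energy :: "('v \<times> 'v \<Rightarrow> 'a) \<Rightarrow> nat \<Rightarrow> real" where
  "dual_energy u k = (\<Sum>(i, j)\<in>E. 1 / weight i j / 2 * (norm (weight i j *\<^sub>R (iterate_sum k i - iterate_sum k j) - u (i, j)))\<^sup>2)"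

text \<open>The primal step uses edge differences of the old iterate, whereas dual ascent would need
  the new one. The mismatch costs weighted squares of the edge differences of the increment, which
  are split among the endpoints and paid by the reserved curvature
  \<open>\<gamma> i * d_i\<close>.\<close>

lemma sdpga_step:
  "(\<Sum>i\<in>UNIV. obj i (x (Suc k) i) - obj i z) + (\<Sum>(i, j)\<in>E. u (i, j) \<bullet> (x (Suc k) i - x (Suc k) j))
      + (dual_energy u (Suc k) - dual_energy u k)
    \<le> (\<Sum>i\<in>UNIV. (1 / c i + sqrt (real k)) / 2
          * ((norm (z - x k i))\<^sup>2 - (norm (z - x (Suc k) i))\<^sup>2))
      + (\<Sum>i\<in>UNIV. noise G v x k i)"
proof -
  let ?d = "\<lambda>i. (norm (x (Suc k) i - x k i))\<^sup>2"
  have step: "obj i (x (Suc k) i) - obj i z + (p k i + s k i) \<bullet> (x (Suc k) i - z)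
      \<le> (1 / c i + sqrt (real k)) / 2 * ((norm (z - x k i))\<^sup>2 - (norm (z - x (Suc k) i))\<^sup>2)
        - (\<gamma> i * real (card (nbrs E i))) / 2 * ?d i + noise G v x k i" for i
    unfolding obj_def noise_def ck[symmetric]
  proof (rule prox_gradient_step[OF xi bounded_dom ck_pos z_dom f_convex gradient lipschitz _ _ x_Suc x_seg])
    show "0 < 1 + sqrt (real k)" by (intro add_pos_nonneg) auto
    show "L i + \<gamma> i * real (card (nbrs E i)) + (1 + sqrt (real k)) \<le> 1 / ck i k"
      using c[of i] unfolding ck by simp
  qed
  have "(\<Sum>i\<in>UNIV. (\<gamma> i * real (card (nbrs E i))) / 2 * ?d i)
      = (\<Sum>i\<in>UNIV. real (card (nbrs E i)) * (\<gamma> i / 2 * ?d i))"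
    by (intro sum.cong) auto
  then have degrees: "(\<Sum>i\<in>UNIV. (\<gamma> i * real (card (nbrs E i))) / 2 * ?d i)
      = (\<Sum>(i, j)\<in>E. \<gamma> i / 2 * ?d i + \<gamma> j / 2 * ?d j)"
    by (simp only: sum_nbrs_eq[OF edge_set])
  have "(\<Sum>(i, j)\<in>E. u (i, j) \<bullet> (x (Suc k) i - x (Suc k) j)) + (dual_energy u (Suc k) - dual_energy u k)
      = (\<Sum>(i, j)\<in>E. u (i, j) \<bullet> (x (Suc k) i - x (Suc k) j)
          + (1 / weight i j / 2 * (norm (weight i j *\<^sub>R ((iterate_sum k i - iterate_sum k j) + (x (Suc k) i - x (Suc k) j)) - u (i, j)))\<^sup>2
            - 1 / weight i j / 2 * (norm (weight i j *\<^sub>R (iterate_sum k i - iterate_sum k j) - u (i, j)))\<^sup>2))"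
    unfolding dual_energy_def iterate_sum_Suc
    by (simp add: sum.distrib[symmetric] sum_subtractf[symmetric] case_prod_unfold algebra_simps)
  also have "\<dots> \<le> (\<Sum>(i, j)\<in>E. (weight i j *\<^sub>R (iterate_sum k i - iterate_sum k j + (x k i - x k j))) \<bullet> (x (Suc k) i - x (Suc k) j)
      + weight i j * (norm ((x (Suc k) i - x (Suc k) j) - (x k i - x k j)))\<^sup>2 / 2)"
    unfolding case_prod_unfold by (intro sum_mono dual_ascent_edge weight_pos)
  also have "\<dots> \<le> (\<Sum>(i, j)\<in>E. (weight i j *\<^sub>R (iterate_sum k i - iterate_sum k j + (x k i - x k j))) \<bullet> (x (Suc k) i - x (Suc k) j)
      + (\<gamma> i / 2 * ?d i + \<gamma> j / 2 * ?d j))"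
  proof (unfold case_prod_unfold, intro sum_mono add_left_mono)
    fix e :: "'v \<times> 'v"
    let ?i = "fst e" and ?j = "snd e"
    have eq: "x (Suc k) ?i - x (Suc k) ?j - (x k ?i - x k ?j)
        = (x (Suc k) ?i - x k ?i) - (x (Suc k) ?j - x k ?j)" by simp
    show "weight ?i ?j * (norm (x (Suc k) ?i - x (Suc k) ?j - (x k ?i - x k ?j)))\<^sup>2 / 2
        \<le> \<gamma> ?i / 2 * ?d ?i + \<gamma> ?j / 2 * ?d ?j"
      using weight_norm_diff_le[of ?i ?j "x (Suc k) ?i - x k ?i" "x (Suc k) ?j - x k ?j"]
      unfolding eq by linarith
  qed
  also have "\<dots> = (\<Sum>i\<in>UNIV. (p k i + s k i) \<bullet> (x (Suc k) i - z))
      + (\<Sum>i\<in>UNIV. (\<gamma> i * real (card (nbrs E i))) / 2 * ?d i)"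
    unfolding coupling_sum degrees case_prod_unfold sum.distrib ..
  finally have "(\<Sum>i\<in>UNIV. obj i (x (Suc k) i) - obj i z)
        + (\<Sum>(i, j)\<in>E. u (i, j) \<bullet> (x (Suc k) i - x (Suc k) j)) + (dual_energy u (Suc k) - dual_energy u k)
      \<le> (\<Sum>i\<in>UNIV. (obj i (x (Suc k) i) - obj i z + (p k i + s k i) \<bullet> (x (Suc k) i - z))
        + (\<gamma> i * real (card (nbrs E i))) / 2 * ?d i)"
    by (simp add: sum.distrib)
  also have "\<dots> \<le> (\<Sum>i\<in>UNIV. (1 / c i + sqrt (real k)) / 2 * ((norm (z - x k i))\<^sup>2 - (norm (z - x (Suc k) i))\<^sup>2)
      + noise G v x k i)"
    using step by (intro sum_mono) (simp add: algebra_simps)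
  finally show ?thesis by (simp add: sum.distrib)
qed

lemma sdpga_ergodic:
  assumes t: "1 \<le> t"
  shows "(\<Sum>i\<in>UNIV. obj i ((1 / real t) *\<^sub>R iterate_sum t i)) - (\<Sum>i\<in>UNIV. obj i z)
      + (1 / real t) * (\<Sum>(i, j)\<in>E. u (i, j) \<bullet> (iterate_sum t i - iterate_sum t j))
    \<le> (1 / real t) * ((\<Sum>(i, j)\<in>E. (1 / \<gamma> i + 1 / \<gamma> j) / 2 * (norm (u (i, j)))\<^sup>2)
        + (\<Sum>i\<in>UNIV. 1 / (2 * c i) * (norm (z - x0 i))\<^sup>2)
        + real CARD('v) * (sqrt (real t) / 2 * D\<^sup>2)
        + (\<Sum>k<t. \<Sum>i\<in>UNIV. noise G v x k i))"
proof -
  let ?A = "\<lambda>i k. (norm (z - x k i))\<^sup>2"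
  have D0: "?A i (Suc k) \<le> D\<^sup>2" for i k
    using norm_diff_le_D[OF x_Suc_dom] by (intro power_mono) auto
  have iterate_sum_shift: "iterate_sum t i = (\<Sum>k<t. x (Suc k) i)" for i
    unfolding iterate_sum_def by (intro sum.reindex_bij_witness[of _ Suc "\<lambda>k. k - 1"]) auto
  have "(\<Sum>k<t. (\<Sum>i\<in>UNIV. obj i (x (Suc k) i) - obj i z)
        + (\<Sum>(i, j)\<in>E. u (i, j) \<bullet> (x (Suc k) i - x (Suc k) j)) + (dual_energy u (Suc k) - dual_energy u k))
      \<le> (\<Sum>k<t. (\<Sum>i\<in>UNIV. (1 / c i + sqrt (real k)) / 2 * (?A i k - ?A i (Suc k)))
        + (\<Sum>i\<in>UNIV. noise G v x k i))"
    by (intro sum_mono sdpga_step)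
  also have "\<dots> = (\<Sum>i\<in>UNIV. \<Sum>k<t. (1 / c i + sqrt (real k)) / 2 * (?A i k - ?A i (Suc k)))
      + (\<Sum>k<t. \<Sum>i\<in>UNIV. noise G v x k i)"
    by (simp only: sum.distrib sum.swap[of _ "{..<t}"])
  also have "(\<Sum>i\<in>UNIV. \<Sum>k<t. (1 / c i + sqrt (real k)) / 2 * (?A i k - ?A i (Suc k)))
      \<le> (\<Sum>i\<in>UNIV. 1 / (2 * c i) * (norm (z - x0 i))\<^sup>2 + sqrt (real t) / 2 * D\<^sup>2)"
  proof (intro sum_mono)
    fix i
    have "0 \<le> (1 / c i + sqrt (real t)) / 2 * ?A i t"
      using c_pos[of i] by (intro mult_nonneg_nonneg) auto
    moreover have "1 / c i / 2 * ?A i 0 = 1 / (2 * c i) * (norm (z - x0 i))\<^sup>2"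
      by (simp add: x_0 mult.commute)
    ultimately show "(\<Sum>k<t. (1 / c i + sqrt (real k)) / 2 * (?A i k - ?A i (Suc k)))
        \<le> 1 / (2 * c i) * (norm (z - x0 i))\<^sup>2 + sqrt (real t) / 2 * D\<^sup>2"
      using telescope_sqrt[of "?A i" "D\<^sup>2" "1 / c i" t, OF D0] by linarith
  qed
  finally have 1: "(\<Sum>k<t. (\<Sum>i\<in>UNIV. obj i (x (Suc k) i) - obj i z)
        + (\<Sum>(i, j)\<in>E. u (i, j) \<bullet> (x (Suc k) i - x (Suc k) j)) + (dual_energy u (Suc k) - dual_energy u k))
      \<le> (\<Sum>i\<in>UNIV. 1 / (2 * c i) * (norm (z - x0 i))\<^sup>2) + real CARD('v) * (sqrt (real t) / 2 * D\<^sup>2)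
        + (\<Sum>k<t. \<Sum>i\<in>UNIV. noise G v x k i)"
    by (simp add: sum.distrib)
  have edges: "(\<Sum>k<t. \<Sum>(i, j)\<in>E. u (i, j) \<bullet> (x (Suc k) i - x (Suc k) j))
      = (\<Sum>(i, j)\<in>E. u (i, j) \<bullet> (iterate_sum t i - iterate_sum t j))"
    unfolding iterate_sum_shift case_prod_unfold
    by (subst sum.swap) (simp add: inner_sum_right[symmetric] sum_subtractf)
  have dual_energy: "(\<Sum>k<t. dual_energy u (Suc k) - dual_energy u k) = dual_energy u t - dual_energy u 0" by (rule sum_lessThan_telescope)
  \<comment> \<open>The multipliers start at zero, so \<open>u\<close> alone is measured, with the
    entries of \<open>Q\<close> as weights.\<close>
  have V0: "dual_energy u 0 = (\<Sum>(i, j)\<in>E. (1 / \<gamma> i + 1 / \<gamma> j) / 2 * (norm (u (i, j)))\<^sup>2)"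
    by (simp add: dual_energy_def iterate_sum_def inverse_weight)
  have Vt: "0 \<le> dual_energy u t"
    unfolding dual_energy_def case_prod_unfold using weight_pos
    by (intro sum_nonneg mult_nonneg_nonneg) (auto intro: less_imp_le)
  \<comment> \<open>Only the objective needs Jensen's inequality; the coupling term is linear and
    passes to the average exactly.\<close>
  have jensen: "obj i ((1 / real t) *\<^sub>R iterate_sum t i) \<le> (1 / real t) * (\<Sum>k<t. obj i (x (Suc k) i))" for i
  proof -
    have "obj i (\<Sum>k<t. (1 / real t) *\<^sub>R x (Suc k) i) \<le> (\<Sum>k<t. (1 / real t) * obj i (x (Suc k) i))"
      using t x_Suc_dom by (intro convex_on_sum[OF _ _ convex_on_obj]) (auto simp: lessThan_empty_iff)
    then show ?thesis by (simp add: iterate_sum_shift scaleR_sum_right sum_distrib_left)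
  qed
  have "(\<Sum>i\<in>UNIV. obj i ((1 / real t) *\<^sub>R iterate_sum t i)) \<le> (\<Sum>i\<in>UNIV. (1 / real t) * (\<Sum>k<t. obj i (x (Suc k) i)))"
    by (intro sum_mono jensen)
  also have "\<dots> = (1 / real t) * (\<Sum>k<t. \<Sum>i\<in>UNIV. obj i (x (Suc k) i) - obj i z) + (\<Sum>i\<in>UNIV. obj i z)"
  proof -
    have "(\<Sum>k<t. \<Sum>i\<in>UNIV. obj i (x (Suc k) i) - obj i z)
        = (\<Sum>i\<in>UNIV. \<Sum>k<t. obj i (x (Suc k) i)) - real t * (\<Sum>i\<in>UNIV. obj i z)"
      by (simp add: sum_subtractf sum.swap[of _ "{..<t}"])
    then show ?thesis using t by (simp add: sum_divide_distrib right_diff_distrib)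
  qed
  finally have 2: "(\<Sum>i\<in>UNIV. obj i ((1 / real t) *\<^sub>R iterate_sum t i)) - (\<Sum>i\<in>UNIV. obj i z)
      \<le> (1 / real t) * (\<Sum>k<t. \<Sum>i\<in>UNIV. obj i (x (Suc k) i) - obj i z)" by simp
  have "(\<Sum>k<t. \<Sum>i\<in>UNIV. obj i (x (Suc k) i) - obj i z) + (\<Sum>(i, j)\<in>E. u (i, j) \<bullet> (iterate_sum t i - iterate_sum t j))
      \<le> (\<Sum>(i, j)\<in>E. (1 / \<gamma> i + 1 / \<gamma> j) / 2 * (norm (u (i, j)))\<^sup>2)
        + (\<Sum>i\<in>UNIV. 1 / (2 * c i) * (norm (z - x0 i))\<^sup>2) + real CARD('v) * (sqrt (real t) / 2 * D\<^sup>2)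
        + (\<Sum>k<t. \<Sum>i\<in>UNIV. noise G v x k i)"
    using 1 Vt unfolding sum.distrib dual_energy edges V0 by linarith
  then have "(1 / real t) * ((\<Sum>k<t. \<Sum>i\<in>UNIV. obj i (x (Suc k) i) - obj i z)
        + (\<Sum>(i, j)\<in>E. u (i, j) \<bullet> (iterate_sum t i - iterate_sum t j)))
      \<le> (1 / real t) * ((\<Sum>(i, j)\<in>E. (1 / \<gamma> i + 1 / \<gamma> j) / 2 * (norm (u (i, j)))\<^sup>2)
        + (\<Sum>i\<in>UNIV. 1 / (2 * c i) * (norm (z - x0 i))\<^sup>2) + real CARD('v) * (sqrt (real t) / 2 * D\<^sup>2)
        + (\<Sum>k<t. \<Sum>i\<in>UNIV. noise G v x k i))"
    by (intro mult_left_mono) auto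
  with 2 show ?thesis unfolding distrib_left by linarith
qed

lemma weighted_edges_le:
  assumes "\<And>i j. (i, j) \<in> E \<Longrightarrow> 1 / \<gamma> i + 1 / \<gamma> j \<le> q"
  shows "(\<Sum>(i, j)\<in>E. (1 / \<gamma> i + 1 / \<gamma> j) / 2 * (norm (u (i, j)))\<^sup>2) \<le> q / 2 * (\<Sum>e\<in>E. (norm (u e))\<^sup>2)"
  unfolding sum_distrib_left case_prod_unfold
proof (rule sum_mono)
  fix e assume "e \<in> E"
  then have "1 / \<gamma> (fst e) + 1 / \<gamma> (snd e) \<le> q" using assms[of "fst e" "snd e"] by simp
  then show "(1 / \<gamma> (fst e) + 1 / \<gamma> (snd e)) / 2 * (norm (u (fst e, snd e)))\<^sup>2 \<le> q / 2 * (norm (u e))\<^sup>2"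
    unfolding prod.collapse by (rule mult_right_mono[OF divide_right_mono]) auto
qed

section \<open>Consequences for the averaged iterates\<close>

context
  fixes xb :: "'v \<Rightarrow> 'a" and t :: nat
  assumes t: "1 \<le> t" and xb: "\<And>i. xb i = (1 / real t) *\<^sub>R (\<Sum>k=1..t. x k i)"
begin

lemma xb_dom: "xb i \<in> edom (\<xi> i)"
proof -
  have "x k i \<in> edom (\<xi> i)" if "k \<in> {1..t}" for k
    using x_Suc_dom[of "k - 1" i] that by simp
  then have "(\<Sum>k=1..t. (1 / real t) *\<^sub>R x k i) \<in> edom (\<xi> i)"
    using t by (intro convex_sum convex_edom[OF xi]) auto
  then show ?thesis by (simp add: xb scaleR_sum_right)
qed

lemma sdpga_ergodic_average:
  assumes q: "\<And>i j. (i, j) \<in> E \<Longrightarrow> 1 / \<gamma> i + 1 / \<gamma> j \<le> q"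
  shows "(\<Sum>i\<in>UNIV. obj i (xb i)) - (\<Sum>i\<in>UNIV. obj i z) + (\<Sum>(i, j)\<in>E. u (i, j) \<bullet> (xb i - xb j))
    \<le> (1 / real t) * (q / 2 * (\<Sum>e\<in>E. (norm (u e))\<^sup>2)
        + (\<Sum>i\<in>UNIV. 1 / (2 * c i) * (norm (z - x0 i))\<^sup>2)
        + real CARD('v) * (sqrt (real t) / 2 * D\<^sup>2)
        + (\<Sum>k<t. \<Sum>i\<in>UNIV. noise G v x k i))"
proof -
  have iterate_sum: "(1 / real t) *\<^sub>R iterate_sum t i = xb i" for i by (simp add: iterate_sum_def xb)
  have "(1 / real t) * (\<Sum>(i, j)\<in>E. u (i, j) \<bullet> (iterate_sum t i - iterate_sum t j)) = (\<Sum>(i, j)\<in>E. u (i, j) \<bullet> (xb i - xb j))"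
    unfolding iterate_sum[symmetric] by (simp only: sum_distrib_left case_prod_unfold scaleR_diff_right[symmetric] inner_scaleR_right)
  with sdpga_ergodic[OF t, of u]
  have "(\<Sum>i\<in>UNIV. obj i (xb i)) - (\<Sum>i\<in>UNIV. obj i z) + (\<Sum>(i, j)\<in>E. u (i, j) \<bullet> (xb i - xb j))
    \<le> (1 / real t) * ((\<Sum>(i, j)\<in>E. (1 / \<gamma> i + 1 / \<gamma> j) / 2 * (norm (u (i, j)))\<^sup>2)
        + (\<Sum>i\<in>UNIV. 1 / (2 * c i) * (norm (z - x0 i))\<^sup>2)
        + real CARD('v) * (sqrt (real t) / 2 * D\<^sup>2)
        + (\<Sum>k<t. \<Sum>i\<in>UNIV. noise G v x k i))"
    by (simp only: iterate_sum)
  also have "\<dots> \<le> (1 / real t) * (q / 2 * (\<Sum>e\<in>E. (norm (u e))\<^sup>2)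
        + (\<Sum>i\<in>UNIV. 1 / (2 * c i) * (norm (z - x0 i))\<^sup>2)
        + real CARD('v) * (sqrt (real t) / 2 * D\<^sup>2)
        + (\<Sum>k<t. \<Sum>i\<in>UNIV. noise G v x k i))"
    by (intro mult_left_mono add_right_mono weighted_edges_le q) auto
  finally show ?thesis .
qed

text \<open>If the gap \<open>\<delta>\<close> is negative, the dual inequality
  \<open>l \<le> \<delta>\<close> gives \<open>- \<delta> \<le> \<delta> - 2 * l\<close>, the
  Lagrangian gap at \<open>u = - 2 B y\<close>. The squared factor 2 against \<open>q / 2\<close>
  produces the constant \<open>2 * (q * r)\<close>. Assumption \<open>r\<close> carries the factor
  \<open>q\<close> so that it also holds without edges, when \<open>q = 0\<close>.\<close>

lemma objective_gap_le:
  assumes q: "\<And>i j. (i, j) \<in> E \<Longrightarrow> 1 / \<gamma> i + 1 / \<gamma> j \<le> q"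
    and dual: "\<And>w. (\<And>i. w i \<in> edom (\<xi> i)) \<Longrightarrow>
      (\<Sum>(i, j)\<in>E. (y i - y j) \<bullet> (w i - w j)) \<le> (\<Sum>i\<in>UNIV. obj i (w i)) - (\<Sum>i\<in>UNIV. obj i z)"
    and r: "q * (\<Sum>(i, j)\<in>E. (norm (y i - y j))\<^sup>2) \<le> q * r" and q0: "0 \<le> q"
  shows "\<bar>(\<Sum>i\<in>UNIV. obj i (xb i)) - (\<Sum>i\<in>UNIV. obj i z)\<bar>
    \<le> (1 / real t) * (2 * (q * r) + (\<Sum>i\<in>UNIV. 1 / (2 * c i) * (norm (z - x0 i))\<^sup>2)
        + real CARD('v) * (sqrt (real t) / 2 * D\<^sup>2)
        + (\<Sum>k<t. \<Sum>i\<in>UNIV. noise G v x k i))"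
proof -
  define \<delta> where "\<delta> = (\<Sum>i\<in>UNIV. obj i (xb i)) - (\<Sum>i\<in>UNIV. obj i z)"
  define T where "T = (\<Sum>i\<in>UNIV. 1 / (2 * c i) * (norm (z - x0 i))\<^sup>2)
        + real CARD('v) * (sqrt (real t) / 2 * D\<^sup>2) + (\<Sum>k<t. \<Sum>i\<in>UNIV. noise G v x k i)"
  have ergodic: "\<delta> + (\<Sum>(i, j)\<in>E. u (i, j) \<bullet> (xb i - xb j))
      \<le> (1 / real t) * (q / 2 * (\<Sum>e\<in>E. (norm (u e))\<^sup>2) + T)" for u
    using sdpga_ergodic_average[OF q, of u] by (simp only: \<delta>_def T_def add.assoc)
  have "0 \<le> q * (\<Sum>(i, j)\<in>E. (norm (y i - y j))\<^sup>2)"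
    using q0 by (intro mult_nonneg_nonneg sum_nonneg) auto
  then have r0: "0 \<le> q * r" using r by simp
  have "\<bar>\<delta>\<bar> \<le> (1 / real t) * (2 * (q * r) + T)"
  proof (cases "0 \<le> \<delta>")
    case True
    have "\<delta> \<le> (1 / real t) * T" using ergodic[of "\<lambda>_. 0"] by simp
    also have "\<dots> \<le> (1 / real t) * (2 * (q * r) + T)" using r0 by (intro mult_left_mono) auto
    finally show ?thesis using True by simp
  next
    case False
    define l where "l = (\<Sum>(i, j)\<in>E. (y i - y j) \<bullet> (xb i - xb j))"
    have "l \<le> \<delta>" unfolding l_def \<delta>_def using xb_dom by (rule dual)
    have "\<delta> - 2 * l \<le> (1 / real t) * (2 * (q * (\<Sum>(i, j)\<in>E. (norm (y i - y j))\<^sup>2)) + T)"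
      using ergodic[of "\<lambda>(i, j). - 2 *\<^sub>R (y i - y j)"]
      by (simp add: l_def case_prod_unfold power_mult_distrib sum_negf sum_distrib_left[symmetric])
    also have "\<dots> \<le> (1 / real t) * (2 * (q * r) + T)" using r by (intro mult_left_mono) auto
    finally show ?thesis using False \<open>l \<le> \<delta>\<close> by linarith
  qed
  then show ?thesis by (simp only: \<delta>_def T_def add.assoc)
qed

text \<open>Pairing \<open>u\<close> with \<open>B xbar\<close> gives \<open>\<beta>\<close> minus
  the dual pairing, and the latter is at most \<open>\<delta>\<close>. Bounding the squared norm of
  \<open>u\<close> by \<open>2 + 2 \<parallel>B y\<parallel>^2\<close> turns \<open>q / 2\<close>
  into \<open>q * (r + 1)\<close>.\<close>

lemma consensus_error_le:
  assumes q: "\<And>i j. (i, j) \<in> E \<Longrightarrow> 1 / \<gamma> i + 1 / \<gamma> j \<le> q"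
    and dual: "\<And>w. (\<And>i. w i \<in> edom (\<xi> i)) \<Longrightarrow>
      (\<Sum>(i, j)\<in>E. (y i - y j) \<bullet> (w i - w j)) \<le> (\<Sum>i\<in>UNIV. obj i (w i)) - (\<Sum>i\<in>UNIV. obj i z)"
    and r: "q * (\<Sum>(i, j)\<in>E. (norm (y i - y j))\<^sup>2) \<le> q * r" and q0: "0 \<le> q"
  shows "sqrt (\<Sum>(i, j)\<in>E. (norm (xb i - xb j))\<^sup>2)
    \<le> (1 / real t) * (q * (r + 1) + (\<Sum>i\<in>UNIV. 1 / (2 * c i) * (norm (z - x0 i))\<^sup>2)
        + real CARD('v) * (sqrt (real t) / 2 * D\<^sup>2)
        + (\<Sum>k<t. \<Sum>i\<in>UNIV. noise G v x k i))"
proof -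
  define \<delta> where "\<delta> = (\<Sum>i\<in>UNIV. obj i (xb i)) - (\<Sum>i\<in>UNIV. obj i z)"
  define T where "T = (\<Sum>i\<in>UNIV. 1 / (2 * c i) * (norm (z - x0 i))\<^sup>2)
        + real CARD('v) * (sqrt (real t) / 2 * D\<^sup>2) + (\<Sum>k<t. \<Sum>i\<in>UNIV. noise G v x k i)"
  define d where "d e = xb (fst e) - xb (snd e)" for e
  define a where "a e = y (fst e) - y (snd e)" for e
  define \<beta> where "\<beta> = sqrt (\<Sum>e\<in>E. (norm (d e))\<^sup>2)"
  \<comment> \<open>If \<open>\<beta> = 0\<close> then all \<open>d e\<close> vanish and \<open>1 / \<beta> = 0\<close>, so no case distinction is needed.\<close>
  define u where "u e = (1 / \<beta>) *\<^sub>R d e - a e" for e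
  have \<beta>2: "\<beta>\<^sup>2 = (\<Sum>e\<in>E. (norm (d e))\<^sup>2)" by (simp add: \<beta>_def sum_nonneg)
  have below: "(\<Sum>e\<in>E. a e \<bullet> d e) \<le> \<delta>"
    using dual[OF xb_dom] by (simp add: \<delta>_def a_def d_def case_prod_unfold)
  have "(\<Sum>e\<in>E. ((1 / \<beta>) *\<^sub>R d e) \<bullet> d e) = 1 / \<beta> * \<beta>\<^sup>2"
    unfolding \<beta>2 sum_distrib_left by (simp add: power2_norm_eq_inner)
  also have "\<dots> = \<beta>" by (simp add: power2_eq_square)
  finally have "(\<Sum>e\<in>E. u e \<bullet> d e) = \<beta> - (\<Sum>e\<in>E. a e \<bullet> d e)"
    by (simp only: u_def inner_diff_left sum_subtractf)
  then have "\<beta> \<le> \<delta> + (\<Sum>e\<in>E. u e \<bullet> d e)" using below by simp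
  also have "\<dots> \<le> (1 / real t) * (q / 2 * (\<Sum>e\<in>E. (norm (u e))\<^sup>2) + T)"
    using sdpga_ergodic_average[OF q, of u]
    by (simp only: \<delta>_def T_def add.assoc d_def case_prod_unfold prod.collapse)
  also have "\<dots> \<le> (1 / real t) * (q * (r + 1) + T)"
  proof (intro mult_left_mono add_right_mono)
    have "(norm (u e))\<^sup>2 \<le> 2 * (norm ((1 / \<beta>) *\<^sub>R d e))\<^sup>2 + 2 * (norm (a e))\<^sup>2" for e
    proof -
      have "0 \<le> (norm ((1 / \<beta>) *\<^sub>R d e + a e))\<^sup>2" by simp
      then show ?thesis unfolding u_def power2_norm_eq_inner
        by (simp add: inner_diff_left inner_diff_right inner_add_left inner_add_right inner_commute)
    qed
    then have "(\<Sum>e\<in>E. (norm (u e))\<^sup>2)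
        \<le> (\<Sum>e\<in>E. 2 * (norm ((1 / \<beta>) *\<^sub>R d e))\<^sup>2 + 2 * (norm (a e))\<^sup>2)"
      by (rule sum_mono)
    also have "\<dots> = 2 * ((1 / \<beta>)\<^sup>2 * \<beta>\<^sup>2) + 2 * (\<Sum>e\<in>E. (norm (a e))\<^sup>2)"
      unfolding \<beta>2 by (simp add: sum.distrib sum_distrib_left power_divide)
    also have "(1 / \<beta>)\<^sup>2 * \<beta>\<^sup>2 \<le> 1" by (simp add: power_divide)
    finally have "(\<Sum>e\<in>E. (norm (u e))\<^sup>2) \<le> 2 + 2 * (\<Sum>e\<in>E. (norm (a e))\<^sup>2)" by simp
    then have "q / 2 * (\<Sum>e\<in>E. (norm (u e))\<^sup>2) \<le> q / 2 * (2 + 2 * (\<Sum>e\<in>E. (norm (a e))\<^sup>2))"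
      using q0 by (intro mult_left_mono) auto
    also have "\<dots> = q + q * (\<Sum>e\<in>E. (norm (a e))\<^sup>2)" by (simp add: algebra_simps)
    also have "\<dots> \<le> q * (r + 1)" using r by (simp add: a_def case_prod_unfold algebra_simps)
    finally show "q / 2 * (\<Sum>e\<in>E. (norm (u e))\<^sup>2) \<le> q * (r + 1)" .
  qed simp
  finally show ?thesis by (simp only: \<beta>_def d_def T_def add.assoc case_prod_unfold)
qed

end

end

end

section \<open>Expectation bounds\<close>

text \<open>\<open>\<kappa>\<close> bounds the multipliers through the subgradients
  \<open>q\<close>. With one node there are no edges and both sides vanish, whatever value the
  \<open>Min\<close> of the empty set has.\<close>

lemma dual_certificate:
  fixes E :: "('v::{finite, linorder} \<times> 'v) set" and q :: "'v \<Rightarrow> real ^ 'n"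
  assumes E: "edge_set E" and con: "connected_graph E"
    and q: "(\<Sum>i\<in>UNIV. q i) = 0" and \<kappa>: "\<And>i. norm (q i) \<le> \<kappa> i"
  shows "\<exists>y. (\<forall>z. (\<Sum>i\<in>UNIV. q i \<bullet> z i) = (\<Sum>(i, j)\<in>E. (y i - y j) \<bullet> (z i - z j)))
    \<and> spectral_norm (Q_mat E \<gamma>) * (\<Sum>(i, j)\<in>E. (norm (y i - y j))\<^sup>2)
      \<le> spectral_norm (Q_mat E \<gamma>) * ((\<Sum>i\<in>UNIV. (\<kappa> i)\<^sup>2) / min_pos_eigenvalue (laplacian E))"
proof (cases "2 \<le> CARD('v)")
  case True
  let ?\<sigma> = "min_pos_eigenvalue (laplacian E)"
  obtain y where y: "\<forall>z. (\<Sum>i\<in>UNIV. q i \<bullet> z i) = (\<Sum>(i, j)\<in>E. (y i - y j) \<bullet> (z i - z j))"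
    "(\<Sum>(i, j)\<in>E. (norm (y i - y j))\<^sup>2) \<le> (\<Sum>i\<in>UNIV. (norm (q i))\<^sup>2) / ?\<sigma>"
    using exists_dual_potential[OF E con True q] by blast
  note y(2)
  also have "(\<Sum>i\<in>UNIV. (norm (q i))\<^sup>2) / ?\<sigma> \<le> (\<Sum>i\<in>UNIV. (\<kappa> i)\<^sup>2) / ?\<sigma>"
    using laplacian_spectral_gap(1)[OF E con True] \<kappa>
    by (intro divide_right_mono sum_mono power_mono) auto
  finally show ?thesis using y(1) spectral_norm_nonneg mult_left_mono by blast
next
  case False
  then have "CARD('v) = 1"
    using zero_less_card_finite[where 'a = 'v] by linarith
  then obtain i where i: "(UNIV :: 'v set) = {i}" by (auto simp: card_1_singleton_iff)
  have eq: "a = b" for a b :: 'v using i by (metis UNIV_I singletonD)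
  have "(a, b) \<notin> E" for a b
  proof
    assume "(a, b) \<in> E"
    then have "a < b" using E by (auto simp: edge_set_def)
    then show False using eq[of a b] by simp
  qed
  then have "E = {}" by auto
  moreover have "q j = 0" for j using q eq[of j i] by (simp add: i)
  ultimately show ?thesis by (simp add: spectral_norm_Q_empty)
qed

text \<open>Each term is at most \<open>sqrt (k + 1) - sqrt k\<close>, because the sum of these two
  roots is at most \<open>2 * (1 + sqrt k)\<close>. Gives the order \<open>sqrt t\<close> of the
  accumulated variance.\<close>

lemma sum_inverse_sqrt_le: "(\<Sum>k<t. 1 / (2 * (1 + sqrt (real k)))) \<le> sqrt (real t)"
proof (induction t)
  case (Suc t)
  define a b where "a = sqrt (real t)" and "b = sqrt (real (Suc t))"
  have a: "0 \<le> a" "a\<^sup>2 = real t" and b: "0 < b" "b\<^sup>2 = real t + 1" by (auto simp: a_def b_def)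
  have "b\<^sup>2 \<le> (a + 1)\<^sup>2" unfolding power2_sum a(2) b(2) using a(1) by simp
  then have ab: "b \<le> a + 1" by (rule power2_le_imp_le) (use a(1) in simp)
  have "(b - a) * (b + a) = b\<^sup>2 - a\<^sup>2" by (simp add: power2_eq_square algebra_simps)
  then have "(b - a) * (b + a) = 1" using a(2) b(2) by simp
  moreover have "a \<le> b" by (simp add: a_def b_def)
  then have "(b - a) * (b + a) \<le> (b - a) * (2 * (1 + a))" using ab by (intro mult_left_mono) auto
  ultimately have "1 / (2 * (1 + a)) \<le> b - a" using a by (simp add: divide_le_eq)
  then show ?case using Suc by (simp add: a_def b_def)
qed simp

section \<open>The extended-valued objective\<close>

lemma objective_eq_real:
  assumes "\<And>i z. \<xi> i z \<noteq> - \<infinity>" "\<And>i. y i \<in> edom (\<xi> i)"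
  shows "objective \<xi> f y = ereal (\<Sum>i\<in>UNIV. real_of_ereal (\<xi> i (y i)) + f i (y i))"
proof -
  have "Phi (\<xi> i) (f i) (y i) = ereal (real_of_ereal (\<xi> i (y i)) + f i (y i))" for i
    using assms(1)[of i "y i"] assms(2)[of i] by (cases "\<xi> i (y i)") (auto simp: Phi_def edom_def)
  then show ?thesis by (simp add: objective_def)
qed

lemma edom_Phi: "edom (Phi \<phi> f) = edom \<phi>"
proof -
  have "\<phi> x + ereal r < \<infinity> \<longleftrightarrow> \<phi> x < \<infinity>" for x r by (cases "\<phi> x") auto
  then show ?thesis by (auto simp: edom_def Phi_def)
qed

lemma objective_minimizer_in_edom:
  assumes xi: "\<And>i z. \<xi> i z \<noteq> - \<infinity>"
    and min: "is_arg_min (\<lambda>z. objective \<xi> f (\<lambda>_. z)) (\<lambda>_. True) x"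
    and z: "\<And>i. z \<in> edom (\<xi> i)"
  shows "x \<in> edom (\<xi> i)"
proof -
  have "objective \<xi> f (\<lambda>_. x) \<le> objective \<xi> f (\<lambda>_. z)"
    using min by (auto simp: is_arg_min_def not_less)
  also have "\<dots> < \<infinity>" using objective_eq_real[of \<xi> "\<lambda>_. z" f] xi z by simp
  finally have "Phi (\<xi> i) (f i) x \<noteq> \<infinity>"
    by (auto simp: objective_def sum_Pinfty)
  then show ?thesis
    using edom_Phi[of "\<xi> i" "f i"] by (auto simp: edom_def less_top[symmetric])
qed

lemma optimal_value_eq:
  assumes "is_arg_min (\<lambda>z. objective \<xi> f (\<lambda>_. z)) (\<lambda>_. True) x"
  shows "optimal_value \<xi> f = objective \<xi> f (\<lambda>_. x)"
  unfolding optimal_value_def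
proof (rule antisym)
  show "objective \<xi> f (\<lambda>_. x) \<le> (INF x. objective \<xi> f (\<lambda>_. x))"
    using assms by (intro INF_greatest) (auto simp: is_arg_min_def not_less)
qed (rule INF_lower[OF UNIV_I])

text \<open>\<open>W\<close> may take negative values; the nonnegativity of the whole bound,
  recorded in \<open>le\<close>, allows its nonnegative integral to be evaluated by linearity of the
  expectation.\<close>

lemma (in prob_space) nn_integral_le_expectation_bound:
  assumes W: "integrable M W" "expectation W \<le> w" and t: "0 < t"
    and le: "\<And>\<omega>. \<omega> \<in> space M \<Longrightarrow> g \<omega> \<le> ennreal (1 / t * (a + W \<omega>)) \<and> 0 \<le> 1 / t * (a + W \<omega>)"
  shows "(\<integral>\<^sup>+\<omega>. g \<omega> \<partial>M) \<le> ennreal (1 / t * (a + w))"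
proof -
  have int: "integrable M (\<lambda>\<omega>. 1 / t * (a + W \<omega>))"
    using W(1) by (intro integrable_mult_right Bochner_Integration.integrable_add) auto
  have "(\<integral>\<^sup>+\<omega>. g \<omega> \<partial>M) \<le> (\<integral>\<^sup>+\<omega>. ennreal (1 / t * (a + W \<omega>)) \<partial>M)"
    using le by (intro nn_integral_mono) auto
  also have "\<dots> = ennreal (expectation (\<lambda>\<omega>. 1 / t * (a + W \<omega>)))"
    using le by (intro nn_integral_eq_integral int AE_I2) auto
  also have "expectation (\<lambda>\<omega>. 1 / t * (a + W \<omega>)) = 1 / t * (a + expectation W)"
  proof -
    have "expectation (\<lambda>\<omega>. a + W \<omega>) = a + expectation W"
      using W(1) by (subst Bochner_Integration.integral_add) (auto simp: prob_space)
    then show ?thesis by simp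
  qed
  also have "ennreal \<dots> \<le> ennreal (1 / t * (a + w))"
    using W(2) t by (intro ennreal_leI mult_left_mono) auto
  finally show ?thesis .
qed

text \<open>The iterates are given only pathwise; repeating the recursion on tables of noise values
  exhibits each as a measurable function of the noise before step \<open>K\<close>. The block
  \<open>A\<close> is fixed while \<open>k\<close> grows, hence \<open>k \<le> K\<close>.\<close>

lemma (in prob_space) sdpga_iterate_factor:
  fixes x s p :: "nat \<Rightarrow> 'v::{finite, linorder} \<Rightarrow> 'a \<Rightarrow> 'b::euclidean_space"
    and \<nu> :: "'v \<Rightarrow> nat \<Rightarrow> 'a \<Rightarrow> 'x"
  assumes run: "\<And>\<omega>. \<omega> \<in> space M \<Longrightarrow> sdpga E \<gamma> \<xi> G ck x0 (\<lambda>i k. \<nu> i k \<omega>)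
      (\<lambda>k i. x k i \<omega>) (\<lambda>k i. s k i \<omega>) (\<lambda>k i. p k i \<omega>)"
    and prox: "\<And>i k. prox (\<lambda>z. ereal (ck i k) * \<xi> i z) \<in> borel_measurable borel"
    and G: "\<And>i. (\<lambda>(x, y). G i x y) \<in> borel_measurable (borel \<Otimes>\<^sub>M D)"
    and A: "A = UNIV \<times> {..<K}" and V: "V = (\<lambda>\<omega>. restrict (\<lambda>a. (case a of (i, k) \<Rightarrow> \<nu> i k) \<omega>) A)"
    and k: "k \<le> K"
  shows "\<exists>h. h \<in> borel_measurable (PiM A (\<lambda>_. D)) \<and> (\<forall>\<omega>\<in>space M. x k i \<omega> = h (V \<omega>))"
proof -
  let ?B = "borel_measurable (PiM A (\<lambda>_. D)) :: (('v \<times> nat \<Rightarrow> 'x) \<Rightarrow> 'b) set"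
  have s: "s k i \<omega> = (\<Sum>j\<in>nbrs E i \<union> {i}. (Gamma_mat E \<gamma> $ i $ j) *\<^sub>R x k j \<omega>)"
    if "\<omega> \<in> space M" for k i \<omega>
    using run[OF that] by (cases k) (simp_all only: sdpga_def)
  \<comment> \<open>\<open>p\<close> must be carried along, since it depends on the whole history;
    \<open>s\<close> is a function of the current iterate.\<close>
  have "\<exists>hx hp. \<forall>i. hx i \<in> ?B \<and> hp i \<in> ?B
      \<and> (\<forall>\<omega>\<in>space M. x k i \<omega> = hx i (V \<omega>) \<and> p k i \<omega> = hp i (V \<omega>))"
    using k
  proof (induction k)
    case 0
    show ?case
      using run by (intro exI[of _ "\<lambda>i _. x0 i"] exI[of _ "\<lambda>_ _. 0"]) (auto simp: sdpga_def)
  next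
    case (Suc k)
    then obtain hx hp where hx: "\<And>i. hx i \<in> ?B" and hp: "\<And>i. hp i \<in> ?B"
      and eq: "\<And>i \<omega>. \<omega> \<in> space M \<Longrightarrow> x k i \<omega> = hx i (V \<omega>) \<and> p k i \<omega> = hp i (V \<omega>)"
      by (metis Suc_leD)
    note [measurable] = hx hp prox
    define hs where "hs i w = (\<Sum>j\<in>nbrs E i \<union> {i}. (Gamma_mat E \<gamma> $ i $ j) *\<^sub>R hx j w)" for i w
    have [measurable]: "hs i \<in> ?B" for i unfolding hs_def by measurable
    have mem: "(i, k) \<in> A" for i using Suc.prems by (simp add: A)
    have [measurable]: "(\<lambda>w. G i (hx i w) (w (i, k))) \<in> ?B" for i
    proof -
      have "(\<lambda>w. (hx i w, w (i, k))) \<in> PiM A (\<lambda>_. D) \<rightarrow>\<^sub>M borel \<Otimes>\<^sub>M D"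
        using hx[of i] measurable_component_singleton[OF mem] by (rule measurable_Pair)
      from measurable_compose[OF this G] show ?thesis by simp
    qed
    define gx where "gx i w = prox (\<lambda>z. ereal (ck i k) * \<xi> i z)
        (hx i w - ck i k *\<^sub>R (G i (hx i w) (w (i, k)) + hp i w + hs i w))" for i w
    have gx: "gx i \<in> ?B" for i
      unfolding gx_def by (rule measurable_compose[OF _ prox]) measurable
    note [measurable] = gx
    define gp where "gp i w = hp i w + (\<Sum>j\<in>nbrs E i \<union> {i}. (Gamma_mat E \<gamma> $ i $ j) *\<^sub>R gx j w)" for i w
    have gp: "gp i \<in> ?B" for i unfolding gp_def by measurable
    have ex: "x (Suc k) i \<omega> = gx i (V \<omega>)" if \<omega>: "\<omega> \<in> space M" for i \<omega>
    proof -
      have "V \<omega> (i, k) = \<nu> i k \<omega>" using mem by (simp add: V)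
      moreover have "s k i \<omega> = hs i (V \<omega>)" using eq[OF \<omega>] s[OF \<omega>] by (simp only: hs_def)
      moreover have "x (Suc k) i \<omega> = prox (\<lambda>z. ereal (ck i k) * \<xi> i z)
          (x k i \<omega> - ck i k *\<^sub>R (G i (x k i \<omega>) (\<nu> i k \<omega>) + p k i \<omega> + s k i \<omega>))"
        using run[OF \<omega>] by (simp add: sdpga_def)
      ultimately show ?thesis using eq[OF \<omega>] by (simp add: gx_def)
    qed
    have ep: "p (Suc k) i \<omega> = gp i (V \<omega>)" if \<omega>: "\<omega> \<in> space M" for i \<omega>
    proof -
      have "p (Suc k) i \<omega> = p k i \<omega> + s (Suc k) i \<omega>" using run[OF \<omega>] by (simp add: sdpga_def)
      then show ?thesis using eq[OF \<omega>] s[OF \<omega>, of "Suc k"] ex[OF \<omega>] by (simp only: gp_def)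
    qed
    show ?case using gx gp ex ep by blast
  qed
  then show ?thesis by blast
qed

lemma (in sdpga_problem) noise_expectation:
  fixes M :: "'w measure" and x s p :: "nat \<Rightarrow> 'v \<Rightarrow> 'w \<Rightarrow> 'a"
    and \<nu> :: "'v \<Rightarrow> nat \<Rightarrow> 'w \<Rightarrow> 'x" and \<D> :: "'x measure"
  assumes prob: "prob_space M"
    and run: "\<And>\<omega>. \<omega> \<in> space M \<Longrightarrow> sdpga E \<gamma> \<xi> G ck x0 (\<lambda>i k. \<nu> i k \<omega>)
      (\<lambda>k i. x k i \<omega>) (\<lambda>k i. s k i \<omega>) (\<lambda>k i. p k i \<omega>)"
    and sfo: "\<And>i. sfo \<D> (f i) (df i) (U i) \<sigma> (G i)"
    and indep: "prob_space.indep_vars M (\<lambda>_. \<D>) (\<lambda>(i, k). \<nu> i k) UNIV"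
    and distr: "\<And>i k. distr M \<D> (\<nu> i k) = \<D>"
  shows "integrable M (\<lambda>\<omega>. noise G (\<lambda>i k. \<nu> i k \<omega>) (\<lambda>k i. x k i \<omega>) k i)"
    "(\<integral>\<omega>. noise G (\<lambda>i k. \<nu> i k \<omega>) (\<lambda>k i. x k i \<omega>) k i \<partial>M) \<le> \<sigma>\<^sup>2 * (1 / (2 * (1 + sqrt (real k))))"
proof -
  interpret prob_space M by fact
  \<comment> \<open>Everything before step \<open>k\<close>, and the single fresh sample: two
    disjoint blocks of an independent family.\<close>
  define A B where "A = (UNIV :: 'v set) \<times> {..<k}" and "B = {(i, k)}"
  define V where "V C = (\<lambda>\<omega>. restrict (\<lambda>a. (case a of (i, k) \<Rightarrow> \<nu> i k) \<omega>) C)" for C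
  have prox: "prox (\<lambda>y. ereal (ck i k) * \<xi> i y) \<in> borel_measurable borel" for i k
    using z_dom[of i] by (intro borel_measurable_prox xi bounded_dom ck_pos) auto
  have G: "(\<lambda>(x, y). G i x y) \<in> borel_measurable (borel \<Otimes>\<^sub>M \<D>)" for i
    using sfo by (simp add: sfo_def)
  obtain h where h: "h \<in> borel_measurable (PiM A (\<lambda>_. \<D>))"
    and xh: "\<And>\<omega>. \<omega> \<in> space M \<Longrightarrow> x k i \<omega> = h (V A \<omega>)"
    using sdpga_iterate_factor[OF run prox G A_def V_def order_refl, of i] by blast
  have "indep_var (PiM A (\<lambda>_. \<D>)) (V A) (PiM B (\<lambda>_. \<D>)) (V B)"
    unfolding V_def by (rule indep_var_restrict[OF indep]) (auto simp: A_def B_def)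
  note joint = indep_var_distr_pair[OF this h measurable_component_singleton[of "(i, k)" B "\<lambda>_. \<D>"]]
  have Vi: "V B \<omega> (i, k) = \<nu> i k \<omega>" for \<omega> by (simp add: V_def B_def)
  have ind: "distr M (borel \<Otimes>\<^sub>M \<D>) (\<lambda>\<omega>. (h (V A \<omega>), \<nu> i k \<omega>))
      = distr M borel (\<lambda>\<omega>. h (V A \<omega>)) \<Otimes>\<^sub>M distr M \<D> (\<nu> i k)"
    using joint unfolding Vi by (simp add: B_def)
  have rv: "\<nu> i k \<in> M \<rightarrow>\<^sub>M \<D>" for i k
    using indep unfolding indep_vars_def by (auto dest: bspec[of _ _ "(i, k)"])
  then have "V A \<in> M \<rightarrow>\<^sub>M PiM A (\<lambda>_. \<D>)"
    unfolding V_def by (intro measurable_restrict) (auto split: prod.split)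
  then have hV: "(\<lambda>\<omega>. h (V A \<omega>)) \<in> borel_measurable M" using h by (rule measurable_compose)
  have XU: "h (V A \<omega>) \<in> U i" if "\<omega> \<in> space M" for \<omega>
    using x_in_U[OF run[OF that], of k i] xh[OF that] by simp
  \<comment> \<open>One radius for all \<open>k\<close>: the start has its own distance from
    \<open>z\<close>, later iterates are within \<open>D\<close>.\<close>
  have bd: "norm (h (V A \<omega>) - z) \<le> norm (x0 i - z) + \<bar>D\<bar>" if \<omega>: "\<omega> \<in> space M" for \<omega>
  proof (cases k)
    case 0
    then show ?thesis using x_0[OF run[OF \<omega>], of i] xh[OF \<omega>] by simp
  next
    case (Suc l)
    have "norm (z - x k i \<omega>) \<le> D" unfolding Suc by (rule norm_diff_le_D[OF x_Suc_dom[OF run[OF \<omega>]]])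
    then have "norm (h (V A \<omega>) - z) \<le> D" using xh[OF \<omega>] by (simp add: norm_minus_commute)
    then show ?thesis using norm_ge_zero[of "x0 i - z"] by linarith
  qed
  define \<Delta> where "\<Delta> \<omega> = G i (h (V A \<omega>)) (\<nu> i k \<omega>) - df i (h (V A \<omega>))" for \<omega>
  have N: "integrable M (\<lambda>\<omega>. (norm (\<Delta> \<omega>))\<^sup>2)" "expectation (\<lambda>\<omega>. (norm (\<Delta> \<omega>))\<^sup>2) \<le> \<sigma>\<^sup>2"
    "integrable M (\<lambda>\<omega>. \<Delta> \<omega> \<bullet> (h (V A \<omega>) - z))" "expectation (\<lambda>\<omega>. \<Delta> \<omega> \<bullet> (h (V A \<omega>) - z)) = 0"
    unfolding \<Delta>_def
    using sfo_noise[OF hV rv ind distr sfo lipschitz_on_continuous_on[OF lipschitz] XU bd] by blast+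
  define W where "W \<omega> = - (\<Delta> \<omega> \<bullet> (h (V A \<omega>) - z)) + (norm (\<Delta> \<omega>))\<^sup>2 / (2 * (1 + sqrt (real k)))" for \<omega>
  have eq: "noise G (\<lambda>i k. \<nu> i k \<omega>) (\<lambda>k i. x k i \<omega>) k i = W \<omega>" if "\<omega> \<in> space M" for \<omega>
    using xh[OF that] by (simp add: noise_def W_def \<Delta>_def)
  have int: "integrable M W"
    unfolding W_def
    by (intro Bochner_Integration.integrable_add Bochner_Integration.integrable_minus N(3)
        integrable_divide_zero N(1))
  then show "integrable M (\<lambda>\<omega>. noise G (\<lambda>i k. \<nu> i k \<omega>) (\<lambda>k i. x k i \<omega>) k i)"
    by (subst Bochner_Integration.integrable_cong[OF refl eq]) auto
  have "expectation (\<lambda>\<omega>. noise G (\<lambda>i k. \<nu> i k \<omega>) (\<lambda>k i. x k i \<omega>) k i) = expectation W"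
    by (intro Bochner_Integration.integral_cong refl eq)
  also have "\<dots> = - expectation (\<lambda>\<omega>. \<Delta> \<omega> \<bullet> (h (V A \<omega>) - z))
      + expectation (\<lambda>\<omega>. (norm (\<Delta> \<omega>))\<^sup>2) / (2 * (1 + sqrt (real k)))"
    unfolding W_def using N(1,3) by (subst Bochner_Integration.integral_add) auto
  also have "\<dots> \<le> \<sigma>\<^sup>2 * (1 / (2 * (1 + sqrt (real k))))"
    using N(2,4) by (simp add: divide_right_mono add_nonneg_nonneg)
  finally show "expectation (\<lambda>\<omega>. noise G (\<lambda>i k. \<nu> i k \<omega>) (\<lambda>k i. x k i \<omega>) k i)
      \<le> \<sigma>\<^sup>2 * (1 / (2 * (1 + sqrt (real k))))" .
qed

theorem corollary9:
  fixes E :: "('v::{finite, linorder} \<times> 'v) set"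
    and \<xi> :: "'v \<Rightarrow> real ^ 'n \<Rightarrow> ereal"
    and f :: "'v \<Rightarrow> real ^ 'n \<Rightarrow> real"
    and df :: "'v \<Rightarrow> real ^ 'n \<Rightarrow> real ^ 'n"
    and U :: "'v \<Rightarrow> (real ^ 'n) set"
    and L \<gamma> c \<kappa> :: "'v \<Rightarrow> real"
    and ck :: "'v \<Rightarrow> nat \<Rightarrow> real"
    and D \<sigma> :: real
    and \<D> :: "'x measure"
    and P :: "'w measure"
    and G :: "'v \<Rightarrow> real ^ 'n \<Rightarrow> 'x \<Rightarrow> real ^ 'n"
    and \<nu> :: "'v \<Rightarrow> nat \<Rightarrow> 'w \<Rightarrow> 'x"
    and x0 :: "'v \<Rightarrow> real ^ 'n"
    and x s p :: "nat \<Rightarrow> 'v \<Rightarrow> 'w \<Rightarrow> real ^ 'n"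
    and xbar :: "nat \<Rightarrow> 'v \<Rightarrow> 'w \<Rightarrow> real ^ 'n"
    and xstar :: "real ^ 'n"
    and t :: nat
  assumes graph: "edge_set E" "connected_graph E"
    and xi: "\<And>i. closed_convex (\<xi> i)" "\<And>i z. \<xi> i z \<noteq> - \<infinity>"
    and f_convex: "\<And>i. closed_convex (\<lambda>z. ereal (f i z))"
    and U_open: "\<And>i. open (U i)"
    and dom_in_U: "\<And>i. edom (\<xi> i) \<subseteq> U i"
    and x0_in_U: "\<And>i z. z \<in> edom (\<xi> i) \<Longrightarrow> closed_segment (x0 i) z \<subseteq> U i"
    and gradient: "\<And>i z. z \<in> U i \<Longrightarrow> GDERIV (f i) z :> df i z"
    and lipschitz: "\<And>i. (L i)-lipschitz_on (U i) (df i)"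
    and sigma: "0 \<le> \<sigma>"
    and sfo: "\<And>i. sfo \<D> (f i) (df i) (U i) \<sigma> (G i)"
    and prob: "prob_space P"
    and nu_indep: "prob_space.indep_vars P (\<lambda>_. \<D>) (\<lambda>(i, k). \<nu> i k) UNIV"
    and nu_distr: "\<And>i k. distr P \<D> (\<nu> i k) = \<D>"
    and solution: "is_arg_min (\<lambda>z. objective \<xi> f (\<lambda>_. z)) (\<lambda>_. True) xstar"
    and ri: "rel_interior (\<Inter>i. edom (\<xi> i)) \<noteq> {}"
    and bounded_dom: "\<And>i. bounded (edom (\<xi> i))"
    and D: "D = Max (range (\<lambda>i. diameter (edom (\<xi> i))))"
    and gamma: "\<And>i. 0 < \<gamma> i"
    and c: "\<And>i. c i = inverse (L i + \<gamma> i * (spectral_norm (copy_mat E i :: real ^ 'n ^ ('v \<times> 'n)))\<^sup>2 + 1)"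
    and ck: "\<And>i k. 1 / ck i k = 1 / c i + sqrt (real k)"
    and run: "\<And>\<omega>. \<omega> \<in> space P \<Longrightarrow>
        sdpga E \<gamma> \<xi> G ck x0 (\<lambda>i k. \<nu> i k \<omega>)
          (\<lambda>k i. x k i \<omega>) (\<lambda>k i. s k i \<omega>) (\<lambda>k i. p k i \<omega>)"
    and xbar: "\<And>t i \<omega>. xbar t i \<omega> = (1 / real t) *\<^sub>R (\<Sum>k=1..t. x k i \<omega>)"
    and kappa: "\<And>i. 0 < \<kappa> i"
      "\<And>i. subdifferential (Phi (\<xi> i) (f i)) xstar \<noteq> {}"
      "\<And>i q. q \<in> subdifferential (Phi (\<xi> i) (f i)) xstar \<Longrightarrow> norm q \<le> \<kappa> i"
    and t: "1 \<le> t"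
  shows "(\<integral>\<^sup>+\<omega>. e2ennreal \<bar>objective \<xi> f (\<lambda>i. xbar t i \<omega>) - optimal_value \<xi> f\<bar> \<partial>P)
      \<le> ennreal (1 / real t *
            (2 * spectral_norm (Q_mat E \<gamma>) / min_pos_eigenvalue (laplacian E) * (\<Sum>i\<in>UNIV. (\<kappa> i)\<^sup>2)
             + (\<Sum>i\<in>UNIV. 1 / (2 * c i) * (norm (xstar - x0 i))\<^sup>2))
          + real CARD('v) / (2 * sqrt (real t)) * (D\<^sup>2 + 2 * \<sigma>\<^sup>2)) \<and>
    (\<integral>\<^sup>+\<omega>. ennreal (sqrt (\<Sum>(i, j)\<in>E. (norm (xbar t i \<omega> - xbar t j \<omega>))\<^sup>2)) \<partial>P)
      \<le> ennreal (1 / real t *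
            (spectral_norm (Q_mat E \<gamma>) * ((\<Sum>i\<in>UNIV. (\<kappa> i)\<^sup>2 / min_pos_eigenvalue (laplacian E)) + 1)
             + (\<Sum>i\<in>UNIV. 1 / (2 * c i) * (norm (xstar - x0 i))\<^sup>2))
          + real CARD('v) / (2 * sqrt (real t)) * (D\<^sup>2 + 2 * \<sigma>\<^sup>2))"
proof -
  interpret P: prob_space P by (rule prob)
  let ?q = "spectral_norm (Q_mat E \<gamma>)" and ?\<sigma> = "min_pos_eigenvalue (laplacian E)"
  let ?r = "(\<Sum>i\<in>UNIV. (\<kappa> i)\<^sup>2) / ?\<sigma>"
  have "(\<Inter>i. edom (\<xi> i)) \<noteq> {}" using ri rel_interior_subset by blast
  then obtain z0 where z0: "\<And>i. z0 \<in> edom (\<xi> i)" by blast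
  have xdom: "xstar \<in> edom (\<xi> i)" for i
    by (rule objective_minimizer_in_edom[OF xi(2) solution z0])
  have inv_c: "1 / c i = L i + \<gamma> i * (spectral_norm (copy_mat E i :: real ^ 'n ^ ('v \<times> 'n)))\<^sup>2 + 1" for i
    by (simp add: c divide_inverse)
  have c_ge: "L i + \<gamma> i * real (card (nbrs E i)) + 1 \<le> 1 / c i" for i
    unfolding inv_c
    using mult_left_mono[OF card_nbrs_le_copy_mat[of E i, where 'n = 'n] less_imp_le[OF gamma[of i]]]
    by simp
  have "0 < 1 / c i" for i
    using c_ge[of i] lipschitz_on_nonneg[OF lipschitz[of i]]
      mult_nonneg_nonneg[OF less_imp_le[OF gamma[of i]], of "real (card (nbrs E i))"] by linarith
  then have c_pos: "0 < c i" for i by (simp add: zero_less_divide_1_iff)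
  interpret sdpga_problem E \<xi> f df U L \<gamma> c ck D x0 xstar
  proof
    show "diameter (edom (\<xi> i)) \<le> D" for i unfolding D by (intro Max_ge) auto
  qed (fact graph xi bounded_dom convex_on_of_closed_convex_ereal[OF f_convex] dom_in_U x0_in_U
      gradient lipschitz gamma c_pos c_ge ck xdom)+
  have obj_eq: "objective \<xi> f y = ereal (\<Sum>i\<in>UNIV. obj i (y i))" if "\<And>i. y i \<in> edom (\<xi> i)" for y
    unfolding obj_def by (rule objective_eq_real[OF xi(2) that])
  have opt: "optimal_value \<xi> f = ereal (\<Sum>i\<in>UNIV. obj i xstar)"
    unfolding optimal_value_eq[OF solution] by (rule obj_eq[OF xdom])
  have "\<exists>q. (\<Sum>i\<in>UNIV. q i) = 0 \<and> (\<forall>i. \<forall>z\<in>edom (\<xi> i). obj i xstar + q i \<bullet> (z - xstar) \<le> obj i z)"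
  proof (rule minimizer_sum_subgradients)
    show "convex_on (edom (\<xi> i)) (obj i)" for i by (rule convex_on_obj)
    \<comment> \<open>The bound \<open>\<kappa>\<close> on the subdifferentials serves as the constraint qualification.\<close>
    show "xstar \<in> interior (edom (\<xi> i))" for i
    proof -
      obtain q where "q \<in> subdifferential (Phi (\<xi> i) (f i)) xstar" using kappa(2) by blast
      moreover have "Phi (\<xi> i) (f i) xstar \<noteq> - \<infinity>"
        using xi(2)[of i xstar] by (cases "\<xi> i xstar") (auto simp: Phi_def)
      ultimately show ?thesis
        using bounded_subdifferential_interior[of "Phi (\<xi> i) (f i)", OF _ _ kappa(3)]
          convex_edom[OF xi, of i] xdom by (simp add: edom_Phi)
    qed
    fix z assume "\<And>i. z \<in> edom (\<xi> i)"
    moreover have "objective \<xi> f (\<lambda>_. xstar) \<le> objective \<xi> f (\<lambda>_. z)"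
      using solution by (auto simp: is_arg_min_def not_less)
    ultimately show "(\<Sum>i\<in>UNIV. obj i xstar) \<le> (\<Sum>i\<in>UNIV. obj i z)"
      using obj_eq[of "\<lambda>_. z"] obj_eq[of "\<lambda>_. xstar"] xdom by simp
  qed
  then obtain q where q0: "(\<Sum>i\<in>UNIV. q i) = 0"
    and q: "\<And>i z. z \<in> edom (\<xi> i) \<Longrightarrow> obj i xstar + q i \<bullet> (z - xstar) \<le> obj i z" by blast
  have Phi_obj: "Phi (\<xi> i) (f i) z = ereal (obj i z)" if "z \<in> edom (\<xi> i)" for i z
    using closed_convex_edom[OF xi that] by (simp add: Phi_def obj_def) (metis plus_ereal.simps(1))
  \<comment> \<open>Outside the domain the inequality is trivial, so \<open>q i\<close> is a
    subgradient of the extended-valued function and \<open>\<kappa> i\<close> bounds its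
    norm.\<close>
  have q_sub: "q i \<in> subdifferential (Phi (\<xi> i) (f i)) xstar" for i
    unfolding subdifferential_def
  proof (intro CollectI allI)
    fix z
    show "Phi (\<xi> i) (f i) xstar + ereal (q i \<bullet> (z - xstar)) \<le> Phi (\<xi> i) (f i) z"
    proof (cases "z \<in> edom (\<xi> i)")
      case True
      then show ?thesis using q[OF True] by (simp add: Phi_obj xdom)
    next
      case False
      then have "Phi (\<xi> i) (f i) z = \<infinity>"
        unfolding edom_Phi[symmetric, of "\<xi> i" "f i"] by (simp add: edom_def)
      then show ?thesis by simp
    qed
  qed
  obtain y where y: "\<And>z. (\<Sum>i\<in>UNIV. q i \<bullet> z i) = (\<Sum>(i, j)\<in>E. (y i - y j) \<bullet> (z i - z j))"
    and r: "?q * (\<Sum>(i, j)\<in>E. (norm (y i - y j))\<^sup>2) \<le> ?q * ?r"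
    using dual_certificate[OF graph q0 kappa(3)[OF q_sub]] by blast
  \<comment> \<open>The subgradient inequalities are summed; \<open>xstar\<close>, the same at every
    node, has no edge differences.\<close>
  have dual: "(\<Sum>(i, j)\<in>E. (y i - y j) \<bullet> (w i - w j)) \<le> (\<Sum>i\<in>UNIV. obj i (w i)) - (\<Sum>i\<in>UNIV. obj i xstar)"
    if "\<And>i. w i \<in> edom (\<xi> i)" for w
  proof -
    have "(\<Sum>(i, j)\<in>E. (y i - y j) \<bullet> (w i - w j)) = (\<Sum>i\<in>UNIV. q i \<bullet> (w i - xstar))"
      unfolding y by simp
    also have "\<dots> \<le> (\<Sum>i\<in>UNIV. obj i (w i) - obj i xstar)"
      using q[OF that] by (intro sum_mono) (simp add: le_diff_eq add.commute)
    finally show ?thesis by (simp add: sum_subtractf)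
  qed
  have Q: "1 / \<gamma> i + 1 / \<gamma> j \<le> ?q" if "(i, j) \<in> E" for i j
    using Q_entry_le_spectral_norm[OF that gamma] by simp
  define A where "A = (\<Sum>i\<in>UNIV. 1 / (2 * c i) * (norm (xstar - x0 i))\<^sup>2)"
  define B where "B = real CARD('v) * (sqrt (real t) / 2 * D\<^sup>2)"
  define W where "W \<omega> = (\<Sum>k<t. \<Sum>i\<in>UNIV. noise G (\<lambda>i k. \<nu> i k \<omega>) (\<lambda>k i. x k i \<omega>) k i)" for \<omega>
  note noise = noise_expectation[OF prob run sfo nu_indep nu_distr]
  have W_int: "integrable P W" unfolding W_def by (intro Bochner_Integration.integrable_sum noise(1))
  have W_le: "P.expectation W \<le> real CARD('v) * (\<sigma>\<^sup>2 * sqrt (real t))"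
  proof -
    have "P.expectation W
        = (\<Sum>k<t. \<Sum>i\<in>UNIV. P.expectation (\<lambda>\<omega>. noise G (\<lambda>i k. \<nu> i k \<omega>) (\<lambda>k i. x k i \<omega>) k i))"
      unfolding W_def by (simp add: noise(1))
    also have "\<dots> \<le> (\<Sum>k<t. \<Sum>i\<in>(UNIV::'v set). \<sigma>\<^sup>2 * (1 / (2 * (1 + sqrt (real k)))))"
      by (intro sum_mono noise(2))
    also have "\<dots> = real CARD('v) * (\<sigma>\<^sup>2 * (\<Sum>k<t. 1 / (2 * (1 + sqrt (real k)))))"
      unfolding sum_constant sum_distrib_left ..
    also have "\<dots> \<le> real CARD('v) * (\<sigma>\<^sup>2 * sqrt (real t))"
      by (intro mult_left_mono sum_inverse_sqrt_le) auto
    finally show ?thesis .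
  qed
  \<comment> \<open>Per node, \<open>sqrt t * (D^2 / 2 + \<sigma>^2) / t\<close> is the last term of
    the theorem; writing \<open>t\<close> as a square leaves a rational identity.\<close>
  have rate: "1 / real t * ((X + A + B) + real CARD('v) * (\<sigma>\<^sup>2 * sqrt (real t)))
      = 1 / real t * (X + A) + real CARD('v) / (2 * sqrt (real t)) * (D\<^sup>2 + 2 * \<sigma>\<^sup>2)" for X
  proof -
    define \<tau> where "\<tau> = sqrt (real t)"
    have \<tau>: "0 < \<tau>" "real t = \<tau> * \<tau>" using t by (auto simp: \<tau>_def)
    show ?thesis
      unfolding B_def \<tau>_def[symmetric] \<tau>(2) using \<tau>(1)
      by (simp add: field_simps)
  qed
  have gap: "e2ennreal \<bar>objective \<xi> f (\<lambda>i. xbar t i \<omega>) - optimal_value \<xi> f\<bar>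
        \<le> ennreal (1 / real t * ((2 * (?q * ?r) + A + B) + W \<omega>))
      \<and> 0 \<le> 1 / real t * ((2 * (?q * ?r) + A + B) + W \<omega>)"
    and err: "ennreal (sqrt (\<Sum>(i, j)\<in>E. (norm (xbar t i \<omega> - xbar t j \<omega>))\<^sup>2))
        \<le> ennreal (1 / real t * ((?q * (?r + 1) + A + B) + W \<omega>))
      \<and> 0 \<le> 1 / real t * ((?q * (?r + 1) + A + B) + W \<omega>)"
    if \<omega>: "\<omega> \<in> space P" for \<omega>
  proof -
    note gap_real = objective_gap_le[OF run[OF \<omega>] t xbar Q dual r spectral_norm_nonneg]
    note err_real = consensus_error_le[OF run[OF \<omega>] t xbar Q dual r spectral_norm_nonneg]
    have "objective \<xi> f (\<lambda>i. xbar t i \<omega>) = ereal (\<Sum>i\<in>UNIV. obj i (xbar t i \<omega>))"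
      by (rule obj_eq) (rule xb_dom[OF run[OF \<omega>] t xbar])
    then have "e2ennreal \<bar>objective \<xi> f (\<lambda>i. xbar t i \<omega>) - optimal_value \<xi> f\<bar>
        = ennreal \<bar>(\<Sum>i\<in>UNIV. obj i (xbar t i \<omega>)) - (\<Sum>i\<in>UNIV. obj i xstar)\<bar>"
      by (simp add: opt e2ennreal_ereal)
    then show "e2ennreal \<bar>objective \<xi> f (\<lambda>i. xbar t i \<omega>) - optimal_value \<xi> f\<bar>
        \<le> ennreal (1 / real t * ((2 * (?q * ?r) + A + B) + W \<omega>))
      \<and> 0 \<le> 1 / real t * ((2 * (?q * ?r) + A + B) + W \<omega>)"
      using gap_real order_trans[OF abs_ge_zero gap_real]
      unfolding A_def[symmetric] B_def[symmetric] W_def[symmetric] by (simp only: ennreal_leI)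
    show "ennreal (sqrt (\<Sum>(i, j)\<in>E. (norm (xbar t i \<omega> - xbar t j \<omega>))\<^sup>2))
        \<le> ennreal (1 / real t * ((?q * (?r + 1) + A + B) + W \<omega>))
      \<and> 0 \<le> 1 / real t * ((?q * (?r + 1) + A + B) + W \<omega>)"
    proof -
      have "0 \<le> sqrt (\<Sum>(i, j)\<in>E. (norm (xbar t i \<omega> - xbar t j \<omega>))\<^sup>2)"
        by (auto intro!: sum_nonneg)
      then show ?thesis
        using err_real order_trans[OF _ err_real]
        unfolding A_def[symmetric] B_def[symmetric] W_def[symmetric] by (simp only: ennreal_leI)
    qed
  qed
  have t0: "0 < real t" using t by simp
  have r1: "2 * ?q / ?\<sigma> * (\<Sum>i\<in>UNIV. (\<kappa> i)\<^sup>2) = 2 * (?q * ?r)" by simp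
  have r2: "(\<Sum>i\<in>UNIV. (\<kappa> i)\<^sup>2 / ?\<sigma>) = ?r" by (simp add: sum_divide_distrib)
  show ?thesis
    unfolding r1 r2 A_def[symmetric] rate[symmetric]
    by (intro conjI P.nn_integral_le_expectation_bound[OF W_int W_le t0] gap err)
qed

end
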